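(* For every $n\ge1$, $$\dim\bigl(\mathrm{pre}\text{-}\mathrm{As}^{\mathrm I}(n)\bigr)=a(n-1),\qquad\text{where}\quad a(m)=\frac{1}{m+1}\sum_{k=0}^{m}\binom{m+1}{k}\binom{m+k+1}{m-k}\quad(m\ge0),$$ and $\mathrm{pre}\text{-}\mathrm{As}^{\mathrm I}(n)$ is the arity $n$ component of the nonsymmetric operad of initial pre-associative algebras. (The numbers $a(m)$ form the OEIS sequence A106228: $1,2,6,21,80,322,\dots$ for $m=0,1,2,\dots$.)
   Context: The ground field has characteristic $0$. $\mathrm{pre}\text{-}\mathrm{As}^{\mathrm I}$ is the nonsymmetric operad generated by two binary operations $\prec,\succ$ subject to the relations $$(x_{1}\succ x_{2})\succ x_{3}+(x_{1}\prec x_{2})\succ x_{3}-x_{1}\succ(x_{2}\succ x_{3})+(x_{1}\prec x_{2})\prec x_{3}-x_{1}\prec(x_{2}\succ x_{3})-x_{1}\prec(x_{2}\prec x_{3})=0,$$ $$x_1\succ(x_2\prec x_3)=(x_1\succ x_2)\prec x_3.$$ *)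

theory Defs
  imports Complex_Main "HOL-Library.Poly_Mapping" "HOL-Library.Tree"
begin

section \<open>Nonsymmetric operads\<close>

text \<open>
  Partial-composition presentation, with inputs numbered from 1. The components of the operad are
  given as subspaces of one ambient vector space; \<open>circ p i q\<close> is the composite of \<open>p\<close>
  with \<open>q\<close> plugged into its \<open>i\<close>-th input, and is only meaningful for \<open>i\<close> between 1 and
  the arity of \<open>p\<close>.
\<close>

locale ns_operad = vector_space scale
  for scale :: "'k::field \<Rightarrow> 'v::ab_group_add \<Rightarrow> 'v" +
  fixes P :: "nat \<Rightarrow> 'v set"
    and circ :: "'v \<Rightarrow> nat \<Rightarrow> 'v \<Rightarrow> 'v"
    and one :: 'v
  assumes subspace_component: "subspace (P n)"
    and one_in: "one \<in> P 1"
    and circ_in: "\<lbrakk>p \<in> P m; q \<in> P n; 1 \<le> i; i \<le> m\<rbrakk> \<Longrightarrow> circ p i q \<in> P (m + n - 1)"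
    and circ_add_left: "\<lbrakk>p \<in> P m; p' \<in> P m; q \<in> P n; 1 \<le> i; i \<le> m\<rbrakk>
          \<Longrightarrow> circ (p + p') i q = circ p i q + circ p' i q"
    and circ_scale_left: "\<lbrakk>p \<in> P m; q \<in> P n; 1 \<le> i; i \<le> m\<rbrakk>
          \<Longrightarrow> circ (scale c p) i q = scale c (circ p i q)"
    and circ_add_right: "\<lbrakk>p \<in> P m; q \<in> P n; q' \<in> P n; 1 \<le> i; i \<le> m\<rbrakk>
          \<Longrightarrow> circ p i (q + q') = circ p i q + circ p i q'"
    and circ_scale_right: "\<lbrakk>p \<in> P m; q \<in> P n; 1 \<le> i; i \<le> m\<rbrakk>
          \<Longrightarrow> circ p i (scale c q) = scale c (circ p i q)"
    and one_left: "p \<in> P m \<Longrightarrow> circ one 1 p = p"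
    and one_right: "\<lbrakk>p \<in> P m; 1 \<le> i; i \<le> m\<rbrakk> \<Longrightarrow> circ p i one = p"
    and circ_sequential: "\<lbrakk>p \<in> P l; q \<in> P m; r \<in> P n; 1 \<le> i; i \<le> l; 1 \<le> j; j \<le> m\<rbrakk>
          \<Longrightarrow> circ (circ p i q) (i - 1 + j) r = circ p i (circ q j r)"
    and circ_parallel: "\<lbrakk>p \<in> P l; q \<in> P m; r \<in> P n; 1 \<le> i; i < k; k \<le> l\<rbrakk>
          \<Longrightarrow> circ (circ p i q) (k - 1 + m) r = circ (circ p k r) i q"


section \<open>The free nonsymmetric operad on a set of binary operations\<close>

text \<open>
  Its arity \<open>n\<close> component has as basis the planar binary trees with \<open>n\<close> leaves whose internal
  vertices are labelled by the operations in \<open>'g\<close>. The library function \<open>size1\<close> counts the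
  leaves of a tree. \<open>graft t i s\<close> replaces the \<open>i\<close>-th leaf of \<open>t\<close> by \<open>s\<close>.
\<close>

fun graft :: "'g tree \<Rightarrow> nat \<Rightarrow> 'g tree \<Rightarrow> 'g tree" where
  "graft \<langle>\<rangle> i s = s"
| "graft \<langle>l, g, r\<rangle> i s =
     (if i \<le> size1 l then \<langle>graft l i s, g, r\<rangle> else \<langle>l, g, graft r (i - size1 l) s\<rangle>)"

definition free_scale :: "'k::field \<Rightarrow> ('g tree \<Rightarrow>\<^sub>0 'k) \<Rightarrow> ('g tree \<Rightarrow>\<^sub>0 'k)" where
  "free_scale c p = Poly_Mapping.map ((*) c) p"

definition of_tree :: "'g tree \<Rightarrow> ('g tree \<Rightarrow>\<^sub>0 'k::field)" where
  "of_tree t = Poly_Mapping.single t 1"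

definition free_component :: "nat \<Rightarrow> ('g tree \<Rightarrow>\<^sub>0 'k::field) set" where
  "free_component n = {p. \<forall>t \<in> Poly_Mapping.keys p. size1 t = n}"

text \<open>Terms in which the input \<open>i\<close> does not exist are dropped.\<close>

definition free_circ ::
    "('g tree \<Rightarrow>\<^sub>0 'k::field) \<Rightarrow> nat \<Rightarrow> ('g tree \<Rightarrow>\<^sub>0 'k) \<Rightarrow> ('g tree \<Rightarrow>\<^sub>0 'k)" where
  "free_circ p i q = (\<Sum>t \<in> Poly_Mapping.keys p. \<Sum>s \<in> Poly_Mapping.keys q.
     if 1 \<le> i \<and> i \<le> size1 t
     then Poly_Mapping.single (graft t i s) (Poly_Mapping.lookup p t * Poly_Mapping.lookup q s)
     else 0)"

lemma lookup_free_scale [simp]: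
  "Poly_Mapping.lookup (free_scale c p) t = c * Poly_Mapping.lookup p t"
  by (simp add: free_scale_def Poly_Mapping.map.rep_eq when_def)

interpretation free: vector_space "free_scale :: 'k::field \<Rightarrow> ('g tree \<Rightarrow>\<^sub>0 'k) \<Rightarrow> _"
  by unfold_locales (auto intro!: poly_mapping_eqI simp: lookup_add algebra_simps)

lemma free_circ_superset:
  assumes "finite A" "Poly_Mapping.keys p \<subseteq> A" "finite B" "Poly_Mapping.keys q \<subseteq> B"
  shows "free_circ p i q = (\<Sum>t \<in> A. \<Sum>s \<in> B.
     if 1 \<le> i \<and> i \<le> size1 t
     then Poly_Mapping.single (graft t i s) (Poly_Mapping.lookup p t * Poly_Mapping.lookup q s)
     else 0)"
proof -
  have "(\<Sum>t \<in> Poly_Mapping.keys p. \<Sum>s \<in> Poly_Mapping.keys q.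
     if 1 \<le> i \<and> i \<le> size1 t
     then Poly_Mapping.single (graft t i s) (Poly_Mapping.lookup p t * Poly_Mapping.lookup q s)
     else 0) = (\<Sum>t \<in> Poly_Mapping.keys p. \<Sum>s \<in> B.
     if 1 \<le> i \<and> i \<le> size1 t
     then Poly_Mapping.single (graft t i s) (Poly_Mapping.lookup p t * Poly_Mapping.lookup q s)
     else 0)"
    using assms by (intro sum.cong sum.mono_neutral_left) (auto simp: in_keys_iff)
  also have "\<dots> = (\<Sum>t \<in> A. \<Sum>s \<in> B.
     if 1 \<le> i \<and> i \<le> size1 t
     then Poly_Mapping.single (graft t i s) (Poly_Mapping.lookup p t * Poly_Mapping.lookup q s)
     else 0)"
    using assms by (intro sum.mono_neutral_left ballI sum.neutral) (auto simp: in_keys_iff)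
  finally show ?thesis by (simp add: free_circ_def)
qed

lemma free_circ_add_left: "free_circ (p + p') i q = free_circ p i q + free_circ p' i q"
proof -
  let ?A = "Poly_Mapping.keys p \<union> Poly_Mapping.keys p' \<union> Poly_Mapping.keys (p + p')"
  let ?B = "Poly_Mapping.keys q"
  show ?thesis
    by (subst (1 2 3) free_circ_superset[of ?A _ ?B])
       (auto simp: sum.distrib[symmetric] lookup_add distrib_right single_add intro!: sum.cong)
qed

lemma free_circ_add_right: "free_circ p i (q + q') = free_circ p i q + free_circ p i q'"
proof -
  let ?B = "Poly_Mapping.keys q \<union> Poly_Mapping.keys q' \<union> Poly_Mapping.keys (q + q')"
  let ?A = "Poly_Mapping.keys p"
  show ?thesis
    by (subst (1 2 3) free_circ_superset[of ?A _ ?B])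
       (auto simp: sum.distrib[symmetric] lookup_add distrib_left single_add intro!: sum.cong)
qed

lemma free_scale_single: "free_scale c (Poly_Mapping.single t a) = Poly_Mapping.single t (c * a)"
  by (rule poly_mapping_eqI) (simp add: lookup_single when_def)

lemma free_circ_scale_left: "free_circ (free_scale c p) i q = free_scale c (free_circ p i q)"
proof -
  let ?A = "Poly_Mapping.keys p \<union> Poly_Mapping.keys (free_scale c p)"
  let ?B = "Poly_Mapping.keys q"
  show ?thesis
    by (subst (1 2) free_circ_superset[of ?A _ ?B])
       (auto simp: free.scale_sum_right free_scale_single mult_ac intro!: sum.cong)
qed

lemma free_circ_scale_right: "free_circ p i (free_scale c q) = free_scale c (free_circ p i q)"
proof -
  let ?B = "Poly_Mapping.keys q \<union> Poly_Mapping.keys (free_scale c q)"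
  let ?A = "Poly_Mapping.keys p"
  show ?thesis
    by (subst (1 2) free_circ_superset[of ?A _ ?B])
       (auto simp: free.scale_sum_right free_scale_single mult_ac intro!: sum.cong)
qed

lemma free_circ_zero_left [simp]: "free_circ 0 i q = 0"
  by (simp add: free_circ_def)

lemma free_circ_zero_right [simp]: "free_circ p i 0 = 0"
  by (simp add: free_circ_def)

lemma free_circ_of_tree:
  "free_circ (of_tree t) i (of_tree s) =
     (if 1 \<le> i \<and> i \<le> size1 t then of_tree (graft t i s) else 0)"
  by (auto simp: free_circ_def of_tree_def)

lemma subspace_free_component: "free.subspace (free_component n)"
  by (auto simp: free.subspace_def free_component_def in_keys_iff lookup_add)

lemma of_tree_in_component: "of_tree t \<in> free_component (size1 t)"
  by (simp add: of_tree_def free_component_def)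

lemma poly_eq_sum_of_tree:
  "p = (\<Sum>t \<in> Poly_Mapping.keys p. free_scale (Poly_Mapping.lookup p t) (of_tree t))"
proof (rule poly_mapping_eqI)
  fix s
  have "Poly_Mapping.lookup (\<Sum>t \<in> Poly_Mapping.keys p.
          free_scale (Poly_Mapping.lookup p t) (of_tree t)) s
      = (\<Sum>t \<in> Poly_Mapping.keys p. if t = s then Poly_Mapping.lookup p t else 0)"
    unfolding lookup_sum
    by (intro sum.cong refl) (auto simp: of_tree_def lookup_single when_def)
  also have "\<dots> = Poly_Mapping.lookup p s"
    by (simp add: in_keys_iff)
  finally show "Poly_Mapping.lookup p s = Poly_Mapping.lookup (\<Sum>t \<in> Poly_Mapping.keys p.
          free_scale (Poly_Mapping.lookup p t) (of_tree t)) s" by simp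
qed

lemma free_component_induct [consumes 1, case_names of_tree zero add scale]:
  assumes "p \<in> free_component n"
    and "\<And>t. size1 t = n \<Longrightarrow> Q (of_tree t)" "Q 0"
    and "\<And>p q. Q p \<Longrightarrow> Q q \<Longrightarrow> Q (p + q)" "\<And>c p. Q p \<Longrightarrow> Q (free_scale c p)"
  shows "Q p"
proof -
  have "Q (\<Sum>t \<in> A. free_scale (Poly_Mapping.lookup p t) (of_tree t))"
    if "finite A" "A \<subseteq> Poly_Mapping.keys p" for A
    using that
  proof (induction A rule: finite_induct)
    case (insert t A)
    then have "size1 t = n" using assms(1) by (auto simp: free_component_def)
    then show ?case using insert assms by auto
  qed (use assms in auto)
  from this[OF finite_keys subset_refl] show ?thesis
    using poly_eq_sum_of_tree[of p] by simp
qed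

lemma size1_graft: "1 \<le> i \<Longrightarrow> i \<le> size1 t \<Longrightarrow> size1 (graft t i s) = size1 t + size1 s - 1"
proof (induction t arbitrary: i)
  case (Node l g r)
  show ?case
  proof (cases "i \<le> size1 l")
    case True
    then show ?thesis using Node by auto
  next
    case False
    then have "size1 (graft r (i - size1 l) s) = size1 r + size1 s - 1"
      using Node.prems by (intro Node.IH) auto
    then show ?thesis using False Node.prems by auto
  qed
qed auto

lemma graft_leaf: "graft t i \<langle>\<rangle> = t"
  by (induction t arbitrary: i) auto

lemma graft_sequential:
  "\<lbrakk>1 \<le> i; i \<le> size1 t; 1 \<le> j; j \<le> size1 s\<rbrakk>
   \<Longrightarrow> graft (graft t i s) (i - 1 + j) u = graft t i (graft s j u)"
proof (induction t arbitrary: i)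
  case (Node l g r)
  show ?case
  proof (cases "i \<le> size1 l")
    case True
    then show ?thesis using Node by (auto simp: size1_graft)
  next
    case False
    then have "graft (graft r (i - size1 l) s) (i - size1 l - 1 + j) u
        = graft r (i - size1 l) (graft s j u)"
      using Node.prems by (intro Node.IH) auto
    moreover have "i - 1 + j - size1 l = i - size1 l - 1 + j" using False by auto
    ultimately show ?thesis using False Node.prems by auto
  qed
qed auto

lemma graft_parallel:
  "\<lbrakk>1 \<le> i; i < k; k \<le> size1 t\<rbrakk>
   \<Longrightarrow> graft (graft t i s) (k - 1 + size1 s) u = graft (graft t k u) i s"
proof (induction t arbitrary: i k)
  case (Node l g r)
  consider "k \<le> size1 l" | "i \<le> size1 l" "size1 l < k" | "size1 l < i"
    using Node.prems by linarith
  then show ?case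
  proof cases
    case 1
    then have "k - 1 + size1 s \<le> size1 (graft l i s)" "i \<le> size1 (graft l k u)"
      using Node.prems by (auto simp: size1_graft)
    then show ?thesis using 1 Node by auto
  next
    case 2
    then have "\<not> k - 1 + size1 s \<le> size1 (graft l i s)"
      "k - 1 + size1 s - size1 (graft l i s) = k - size1 l"
      using Node.prems by (auto simp: size1_graft)
    then show ?thesis using 2 by auto
  next
    case 3
    then have "graft (graft r (i - size1 l) s) (k - size1 l - 1 + size1 s) u
        = graft (graft r (k - size1 l) u) (i - size1 l) s"
      using Node.prems by (intro Node.IH) auto
    moreover have "k - 1 + size1 s - size1 l = k - size1 l - 1 + size1 s"
      "\<not> k - 1 + size1 s \<le> size1 l"
      using 3 Node.prems by auto
    ultimately show ?thesis using 3 Node.prems by auto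
  qed
qed auto

lemma free_circ_in:
  assumes "p \<in> free_component m" "q \<in> free_component n" "1 \<le> i" "i \<le> m"
  shows "free_circ p i q \<in> free_component (m + n - 1)"
  using assms(1)
proof (induction rule: free_component_induct)
  case (of_tree t)
  show ?case using assms(2)
  proof (induction rule: free_component_induct)
    case (of_tree s)
    have "size1 (graft t i s) = m + n - 1"
      using size1_graft[of i t s] assms(3,4) \<open>size1 t = m\<close> \<open>size1 s = n\<close> by simp
    then show ?case using of_tree_in_component[of "graft t i s"] assms(3,4) \<open>size1 t = m\<close>
      by (simp add: free_circ_of_tree)
  qed (auto simp: free_circ_add_right free_circ_scale_right
        intro!: free.subspace_0 free.subspace_add free.subspace_scale subspace_free_component)
qed (auto simp: free_circ_add_left free_circ_scale_left
        intro!: free.subspace_0 free.subspace_add free.subspace_scale subspace_free_component)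

interpretation free: ns_operad "free_scale :: 'k::field \<Rightarrow> ('g tree \<Rightarrow>\<^sub>0 'k) \<Rightarrow> _"
  free_component free_circ "of_tree \<langle>\<rangle>"
proof (unfold_locales, goal_cases)
  case (1 n)
  show ?case by (rule subspace_free_component)
next
  case 2
  show ?case using of_tree_in_component[of "\<langle>\<rangle>"] by simp
next
  case 3
  then show ?case by (rule free_circ_in)
next
  case (8 p m)
  then show ?case
    by (induction rule: free_component_induct)
       (auto simp: free_circ_of_tree free_circ_add_right free_circ_scale_right)
next
  case (9 p m i)
  from 9(1) show ?case
    by (induction rule: free_component_induct)
       (use 9(2,3) in \<open>auto simp: free_circ_of_tree free_circ_add_left free_circ_scale_left graft_leaf\<close>)
next
  case (10 p l q m r n i j)
  note h = 10
  from h(1) show ?case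
  proof (induction rule: free_component_induct)
    case (of_tree t)
    show ?case using h(2)
    proof (induction rule: free_component_induct)
      case (of_tree s)
      show ?case using h(3)
      proof (induction rule: free_component_induct)
        case (of_tree u)
        then show ?case
          using h(4-7) \<open>size1 t = l\<close> \<open>size1 s = m\<close> graft_sequential[of i t j s u]
          by (auto simp: free_circ_of_tree size1_graft)
      qed (auto simp: free_circ_add_right free_circ_scale_right)
    qed (auto simp: free_circ_add_right free_circ_scale_right free_circ_add_left free_circ_scale_left)
  qed (auto simp: free_circ_add_left free_circ_scale_left)
next
  case (11 p l q m r n i k)
  note h = 11
  from h(1) show ?case
  proof (induction rule: free_component_induct)
    case (of_tree t)
    show ?case using h(2)
    proof (induction rule: free_component_induct)
      case (of_tree s)
      show ?case using h(3)
      proof (induction rule: free_component_induct)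
        case (of_tree u)
        have "k - 1 + m \<le> size1 (graft t i s)" "i \<le> size1 (graft t k u)"
          using h(4-6) \<open>size1 t = l\<close> \<open>size1 s = m\<close> by (auto simp: size1_graft)
        then show ?case
          using h(4-6) \<open>size1 t = l\<close> \<open>size1 s = m\<close> graft_parallel[of i k t s u]
          by (auto simp: free_circ_of_tree)
      qed (auto simp: free_circ_add_right free_circ_scale_right free_circ_add_left free_circ_scale_left)
    qed (auto simp: free_circ_add_right free_circ_scale_right free_circ_add_left free_circ_scale_left)
  qed (auto simp: free_circ_add_left free_circ_scale_left)
qed (simp_all only: free_circ_add_left free_circ_add_right free_circ_scale_left free_circ_scale_right)



section \<open>Operadic ideals of the free operad\<close>

text \<open>
  \<open>free_ideal R n\<close> is the arity \<open>n\<close> component of the operadic ideal generated by a set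
  \<open>R\<close> of homogeneous elements.
\<close>

inductive free_ideal ::
    "('g tree \<Rightarrow>\<^sub>0 'k::field) set \<Rightarrow> nat \<Rightarrow> ('g tree \<Rightarrow>\<^sub>0 'k) \<Rightarrow> bool"
  for R where
  generator: "\<lbrakk>r \<in> R; r \<in> free_component n\<rbrakk> \<Longrightarrow> free_ideal R n r"
| zero: "free_ideal R n 0"
| add: "\<lbrakk>free_ideal R n p; free_ideal R n q\<rbrakk> \<Longrightarrow> free_ideal R n (p + q)"
| scale: "free_ideal R n p \<Longrightarrow> free_ideal R n (free_scale c p)"
| circ_left: "\<lbrakk>free_ideal R m p; q \<in> free_component n; 1 \<le> i; i \<le> m\<rbrakk>
    \<Longrightarrow> free_ideal R (m + n - 1) (free_circ p i q)"
| circ_right: "\<lbrakk>p \<in> free_component m; free_ideal R n q; 1 \<le> i; i \<le> m\<rbrakk>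
    \<Longrightarrow> free_ideal R (m + n - 1) (free_circ p i q)"

definition total_ideal :: "('g tree \<Rightarrow>\<^sub>0 'k::field) set \<Rightarrow> ('g tree \<Rightarrow>\<^sub>0 'k) set" where
  "total_ideal R = free.span (\<Union>n. {p. free_ideal R n p})"

lemma subspace_total_ideal: "free.subspace (total_ideal R)"
  by (simp add: total_ideal_def)

lemma free_ideal_in_component: "free_ideal R n p \<Longrightarrow> p \<in> free_component n"
  by (induction rule: free_ideal.induct)
     (simp_all only: free_circ_in free.subspace_0 free.subspace_add free.subspace_scale
        subspace_free_component)

definition proj :: "nat \<Rightarrow> ('g tree \<Rightarrow>\<^sub>0 'k::field) \<Rightarrow> ('g tree \<Rightarrow>\<^sub>0 'k)" where
  "proj n p = (\<Sum>t \<in> {t \<in> Poly_Mapping.keys p. size1 t = n}.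
     Poly_Mapping.single t (Poly_Mapping.lookup p t))"

lemma lookup_proj:
  "Poly_Mapping.lookup (proj n p) t = (if size1 t = n then Poly_Mapping.lookup p t else 0)"
proof -
  have "Poly_Mapping.lookup (proj n p) t =
     (\<Sum>s \<in> {t \<in> Poly_Mapping.keys p. size1 t = n}. if s = t then Poly_Mapping.lookup p t else 0)"
    unfolding proj_def lookup_sum
    by (intro sum.cong refl) (auto simp: lookup_single when_def)
  also have "\<dots> = (if size1 t = n then Poly_Mapping.lookup p t else 0)"
    by (subst sum.delta) (auto simp: in_keys_iff)
  finally show ?thesis .
qed

lemma proj_component: "p \<in> free_component m \<Longrightarrow> proj n p = (if n = m then p else 0)"
  by (rule poly_mapping_eqI) (auto simp: lookup_proj free_component_def in_keys_iff)

lemma total_ideal_proj: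
  assumes "p \<in> total_ideal R"
  shows "free_ideal R n (proj n p)"
proof -
  have "free.subspace {p. free_ideal R n (proj n p)}"
  proof (rule free.subspaceI)
    show "0 \<in> {p. free_ideal R n (proj n p)}"
      by (simp add: proj_def free_ideal.zero)
  next
    fix x y assume "x \<in> {p. free_ideal R n (proj n p)}" "y \<in> {p. free_ideal R n (proj n p)}"
    moreover have "proj n (x + y) = proj n x + proj n y"
      by (rule poly_mapping_eqI) (simp add: lookup_proj lookup_add)
    ultimately show "x + y \<in> {p. free_ideal R n (proj n p)}"
      by (simp add: free_ideal.add)
  next
    fix c x assume "x \<in> {p. free_ideal R n (proj n p)}"
    moreover have "proj n (free_scale c x) = free_scale c (proj n x)"
      by (rule poly_mapping_eqI) (simp add: lookup_proj)
    ultimately show "free_scale c x \<in> {p. free_ideal R n (proj n p)}"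
      by (simp add: free_ideal.scale)
  qed
  moreover have "(\<Union>n. {p. free_ideal R n p}) \<subseteq> {p. free_ideal R n (proj n p)}"
    by (auto simp: proj_component[OF free_ideal_in_component] free_ideal.zero)
  ultimately show ?thesis
    using assms free.span_minimal unfolding total_ideal_def by blast
qed

lemma total_ideal_component:
  assumes "p \<in> free_component n"
  shows "p \<in> total_ideal R \<longleftrightarrow> free_ideal R n p"
proof
  assume "p \<in> total_ideal R"
  from total_ideal_proj[OF this, of n] show "free_ideal R n p"
    using assms by (simp add: proj_component)
next
  assume "free_ideal R n p"
  then show "p \<in> total_ideal R"
    unfolding total_ideal_def by (intro free.span_base) auto
qed

lemma poly_induct [case_names of_tree zero add scale]:
  assumes "\<And>t. Q (of_tree t)" "Q 0"
    and "\<And>p q. Q p \<Longrightarrow> Q q \<Longrightarrow> Q (p + q)" "\<And>c p. Q p \<Longrightarrow> Q (free_scale c p)"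
  shows "Q p"
proof -
  have "Q (\<Sum>t \<in> A. free_scale (Poly_Mapping.lookup p t) (of_tree t))" if "finite A" for A
    using that by (induction A rule: finite_induct) (use assms in auto)
  from this[OF finite_keys[of p]] show ?thesis
    using poly_eq_sum_of_tree[of p] by simp
qed

lemma free_circ_out_of_range:
  assumes "p \<in> free_component m" "\<not> (1 \<le> i \<and> i \<le> m)"
  shows "free_circ p i q = 0"
  using assms unfolding free_circ_def free_component_def
  by (intro sum.neutral ballI) auto

lemma total_ideal_circ_left:
  assumes "p \<in> total_ideal R"
  shows "free_circ p i q \<in> total_ideal R"
proof -
  have "free.subspace {p. free_circ p i q \<in> total_ideal R}"
    using subspace_total_ideal[of R]
    by (auto simp: free.subspace_def free_circ_add_left free_circ_scale_left)
  moreover have "free_circ p i q \<in> total_ideal R" if p: "free_ideal R m p" for m p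
  proof (induction q rule: poly_induct)
    case (of_tree t)
    show ?case
    proof (cases "1 \<le> i \<and> i \<le> m")
      case True
      then show ?thesis unfolding total_ideal_def
        using free_ideal.circ_left[OF p of_tree_in_component[of t], of i]
        by (intro free.span_base) auto
    next
      case False
      then show ?thesis
        using free_circ_out_of_range[OF free_ideal_in_component[OF p]] subspace_total_ideal[of R]
        by (simp add: free.subspace_0)
    qed
  qed (use subspace_total_ideal[of R] in
        \<open>auto simp: free.subspace_def free_circ_add_right free_circ_scale_right\<close>)
  then have "(\<Union>n. {p. free_ideal R n p}) \<subseteq> {p. free_circ p i q \<in> total_ideal R}"
    by auto
  ultimately show ?thesis
    using assms free.span_minimal unfolding total_ideal_def by blast
qed

lemma total_ideal_circ_right:
  assumes "q \<in> total_ideal R"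
  shows "free_circ p i q \<in> total_ideal R"
proof -
  have "free.subspace {q. free_circ p i q \<in> total_ideal R}"
    using subspace_total_ideal[of R]
    by (auto simp: free.subspace_def free_circ_add_right free_circ_scale_right)
  moreover have "free_circ p i q \<in> total_ideal R" if q: "free_ideal R n q" for n q
  proof (induction p rule: poly_induct)
    case (of_tree t)
    show ?case
    proof (cases "1 \<le> i \<and> i \<le> size1 t")
      case True
      then show ?thesis unfolding total_ideal_def
        using free_ideal.circ_right[OF of_tree_in_component[of t] q, of i]
        by (intro free.span_base) auto
    next
      case False
      then show ?thesis
        using free_circ_out_of_range[OF of_tree_in_component[of t] False, of q]
          subspace_total_ideal[of R]
        by (simp add: free.subspace_0)
    qed
  qed (use subspace_total_ideal[of R] in
        \<open>auto simp: free.subspace_def free_circ_add_left free_circ_scale_left\<close>)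
  then have "(\<Union>n. {p. free_ideal R n p}) \<subseteq> {q. free_circ p i q \<in> total_ideal R}"
    by auto
  ultimately show ?thesis
    using assms free.span_minimal unfolding total_ideal_def by blast
qed


section \<open>The operad of initial pre-associative algebras\<close>

datatype pre_op = Prec | Succ

abbreviation prec_tree :: "pre_op tree \<Rightarrow> pre_op tree \<Rightarrow> pre_op tree" (infix \<open>\<prec>\<^sub>t\<close> 65) where
  "l \<prec>\<^sub>t r \<equiv> \<langle>l, Prec, r\<rangle>"

abbreviation succ_tree :: "pre_op tree \<Rightarrow> pre_op tree \<Rightarrow> pre_op tree" (infix \<open>\<succ>\<^sub>t\<close> 65) where
  "l \<succ>\<^sub>t r \<equiv> \<langle>l, Succ, r\<rangle>"

text \<open>
  In a nonsymmetric relation the variables occur in the order 1, 2, 3 in every term, so each of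
  them is written as a leaf.
\<close>

definition preAsI_relators :: "(pre_op tree \<Rightarrow>\<^sub>0 'k::field) set" where
  "preAsI_relators =
    {of_tree ((\<langle>\<rangle> \<succ>\<^sub>t \<langle>\<rangle>) \<succ>\<^sub>t \<langle>\<rangle>) + of_tree ((\<langle>\<rangle> \<prec>\<^sub>t \<langle>\<rangle>) \<succ>\<^sub>t \<langle>\<rangle>)
       - of_tree (\<langle>\<rangle> \<succ>\<^sub>t (\<langle>\<rangle> \<succ>\<^sub>t \<langle>\<rangle>)) + of_tree ((\<langle>\<rangle> \<prec>\<^sub>t \<langle>\<rangle>) \<prec>\<^sub>t \<langle>\<rangle>)
       - of_tree (\<langle>\<rangle> \<prec>\<^sub>t (\<langle>\<rangle> \<succ>\<^sub>t \<langle>\<rangle>)) - of_tree (\<langle>\<rangle> \<prec>\<^sub>t (\<langle>\<rangle> \<prec>\<^sub>t \<langle>\<rangle>)),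
     of_tree (\<langle>\<rangle> \<succ>\<^sub>t (\<langle>\<rangle> \<prec>\<^sub>t \<langle>\<rangle>)) - of_tree ((\<langle>\<rangle> \<succ>\<^sub>t \<langle>\<rangle>) \<prec>\<^sub>t \<langle>\<rangle>)}"

lemma preAsI_relators_in_component:
  assumes "r \<in> preAsI_relators"
  shows "r \<in> free_component 3"
proof -
  have t: "of_tree t \<in> free_component 3" if "size1 t = 3" for t :: "pre_op tree"
    using of_tree_in_component[of t] that by simp
  show ?thesis
    using assms unfolding preAsI_relators_def
    by (auto intro!: t free.subspace_add free.subspace_diff subspace_free_component)
qed

definition preAsI_rel :: "(pre_op tree \<Rightarrow>\<^sub>0 'k::field) \<Rightarrow> (pre_op tree \<Rightarrow>\<^sub>0 'k) \<Rightarrow> bool" where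
  "preAsI_rel p q \<longleftrightarrow> p - q \<in> total_ideal preAsI_relators"

lemma equivp_preAsI_rel: "equivp preAsI_rel"
proof (rule equivpI)
  show "reflp preAsI_rel"
    by (rule reflpI) (simp add: preAsI_rel_def free.subspace_0[OF subspace_total_ideal])
  show "symp preAsI_rel"
    by (rule sympI) (auto simp: preAsI_rel_def dest: free.subspace_neg[OF subspace_total_ideal])
  show "transp preAsI_rel"
    by (rule transpI)
       (auto simp: preAsI_rel_def dest: free.subspace_add[OF subspace_total_ideal])
qed

text \<open>
  The direct sum of the components of the quotient of the free operad by the ideal generated by
  the relators.
\<close>

quotient_type (overloaded) 'k preAsI = "pre_op tree \<Rightarrow>\<^sub>0 'k::field" / preAsI_rel
  by (rule equivp_preAsI_rel)

instantiation preAsI :: (field) ab_group_add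
begin

lift_definition zero_preAsI :: "'a preAsI" is 0 .

lift_definition plus_preAsI :: "'a preAsI \<Rightarrow> 'a preAsI \<Rightarrow> 'a preAsI" is "(+)"
  by (auto simp: preAsI_rel_def add_diff_add intro: free.subspace_add subspace_total_ideal)

lift_definition uminus_preAsI :: "'a preAsI \<Rightarrow> 'a preAsI" is uminus
  unfolding preAsI_rel_def by (drule free.subspace_neg[OF subspace_total_ideal]) simp

lift_definition minus_preAsI :: "'a preAsI \<Rightarrow> 'a preAsI \<Rightarrow> 'a preAsI" is "(-)"
  unfolding preAsI_rel_def
  by (drule (1) free.subspace_diff[OF subspace_total_ideal]) (simp add: algebra_simps)

instance
  by standard (transfer, simp add: equivp_reflp[OF equivp_preAsI_rel] algebra_simps)+

end

lift_definition preAsI_scale :: "'k::field \<Rightarrow> 'k preAsI \<Rightarrow> 'k preAsI" is free_scale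
  unfolding preAsI_rel_def
  by (simp add: free.scale_right_diff_distrib[symmetric]
        free.subspace_scale[OF subspace_total_ideal])

lift_definition preAsI_circ :: "'k::field preAsI \<Rightarrow> nat \<Rightarrow> 'k preAsI \<Rightarrow> 'k preAsI" is free_circ
proof -
  fix p p' q q' :: "pre_op tree \<Rightarrow>\<^sub>0 'k" and i :: nat
  assume "preAsI_rel p p'" "preAsI_rel q q'"
  moreover have "free_circ p i q - free_circ p' i q'
      = free_circ (p - p') i q + free_circ p' i (q - q')"
    using free_circ_add_left[of "p - p'" p' i q] free_circ_add_right[of p' i "q - q'" q']
    by (simp add: algebra_simps)
  ultimately show "preAsI_rel (free_circ p i q) (free_circ p' i q')"
    unfolding preAsI_rel_def
    by (simp add: free.subspace_add[OF subspace_total_ideal]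
          total_ideal_circ_left total_ideal_circ_right)
qed

lift_definition preAsI_one :: "'k::field preAsI" is "of_tree \<langle>\<rangle>" .

definition preAsI_component :: "nat \<Rightarrow> 'k::field preAsI set" where
  "preAsI_component n = abs_preAsI ` free_component n"

text \<open>
  Hence the component of arity \<open>n\<close> is the quotient of the free component by the arity \<open>n\<close>
  component of the ideal.
\<close>

lemma abs_preAsI_eq_iff:
  assumes "p \<in> free_component n" "q \<in> free_component n"
  shows "abs_preAsI p = abs_preAsI q \<longleftrightarrow> free_ideal preAsI_relators n (p - q)"
  using assms total_ideal_component[of "p - q" n preAsI_relators]
  by (simp add: preAsI.abs_eq_iff preAsI_rel_def free.subspace_diff subspace_free_component)

interpretation preAsI: vector_space "preAsI_scale :: 'k::field \<Rightarrow> 'k preAsI \<Rightarrow> 'k preAsI"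
  by unfold_locales
     (transfer, simp add: equivp_reflp[OF equivp_preAsI_rel] free.scale_right_distrib
        free.scale_left_distrib)+

lemma preAsI_circ_bilinear:
  "preAsI_circ (p + p') i q = preAsI_circ p i q + preAsI_circ p' i q"
  "preAsI_circ p i (q + q') = preAsI_circ p i q + preAsI_circ p i q'"
  "preAsI_circ (preAsI_scale c p) i q = preAsI_scale c (preAsI_circ p i q)"
  "preAsI_circ p i (preAsI_scale c q) = preAsI_scale c (preAsI_circ p i q)"
  by (transfer, simp add: free_circ_add_left free_circ_add_right free_circ_scale_left
        free_circ_scale_right equivp_reflp[OF equivp_preAsI_rel])+

interpretation preAsI: ns_operad "preAsI_scale :: 'k::field \<Rightarrow> 'k preAsI \<Rightarrow> 'k preAsI"
  preAsI_component preAsI_circ preAsI_one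
proof (unfold_locales, goal_cases)
  case (1 n)
  have "0 \<in> preAsI_component n"
    unfolding preAsI_component_def zero_preAsI.abs_eq
    by (intro imageI free.subspace_0 subspace_free_component)
  moreover have "x + y \<in> preAsI_component n"
    if "x \<in> preAsI_component n" "y \<in> preAsI_component n" for x y
    using that unfolding preAsI_component_def
    by (auto simp: plus_preAsI.abs_eq intro!: imageI free.subspace_add subspace_free_component)
  moreover have "preAsI_scale c x \<in> preAsI_component n" if "x \<in> preAsI_component n" for c x
    using that unfolding preAsI_component_def
    by (auto simp: preAsI_scale.abs_eq intro!: imageI free.subspace_scale subspace_free_component)
  ultimately show ?case by (rule preAsI.subspaceI)
next
  case 2
  show ?case by (simp only: preAsI_component_def preAsI_one.abs_eq imageI free.one_in)
next
  case (3 p m q n i)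
  then show ?case unfolding preAsI_component_def
    by (auto simp only: preAsI_circ.abs_eq intro!: imageI free_circ_in)
next
  case (8 p m)
  then show ?case unfolding preAsI_component_def
    by (auto simp only: preAsI_one.abs_eq preAsI_circ.abs_eq free.one_left)
next
  case (9 p m i)
  then show ?case unfolding preAsI_component_def
    by (auto simp only: preAsI_one.abs_eq preAsI_circ.abs_eq free.one_right)
next
  case (10 p l q m r n i j)
  then show ?case unfolding preAsI_component_def
    by (auto simp only: preAsI_circ.abs_eq free.circ_sequential)
next
  case (11 p l q m r n i k)
  then show ?case unfolding preAsI_component_def
    by (auto simp only: preAsI_circ.abs_eq free.circ_parallel)
qed (simp_all only: preAsI_circ_bilinear)


section \<open>The sequence A106228\<close>

definition A106228 :: "nat \<Rightarrow> rat" where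
  "A106228 m = 1 / of_nat (m + 1) *
     (\<Sum>k = 0..m. of_nat ((m + 1) choose k) * of_nat ((m + k + 1) choose (m - k)))"

end

theory Submission
  imports Defs "HOL-Computational_Algebra.Formal_Power_Series"
begin

text \<open>
  With \<open>x * y = (x \<prec> y) + (x \<succ> y)\<close> the two relations say that \<open>*\<close> is associative and that
  \<open>(x \<succ> y) \<prec> z = x \<succ> (y \<prec> z)\<close>. As an associative algebra for \<open>*\<close>, the free algebra on
  one generator \<open>x\<close> turns out to be free on letters of two kinds: \<open>x\<close> itself and \<open>(x * v) \<succ> a\<close>,
  where \<open>v\<close> is a possibly empty and \<open>a\<close> a nonempty word. The relations force
  \<open>((w \<succ> a) * r) \<succ> z = (w \<succ> a) * (r \<succ> z) + w \<succ> (a \<prec> (r \<prec> z) - (a \<prec> r) \<prec> z)\<close>,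
  so words span; conversely this formula defines an operation on the space of words that satisfies
  the relations, so words are linearly independent. The generating series of nonempty words
  satisfies \<open>f = X (1 + f) (1 + f + f\<^sup>2)\<close>, and Lagrange inversion gives the coefficients.
\<close>

section \<open>Lagrange inversion and counting\<close>

unbundle fps_syntax

text \<open>Strong induction on n: \<open>f ^ k\<close> is X^k times \<phi>^k composed with f, so
  its n-th coefficient is a combination of coefficients of powers of f at n - k < n. The induction
  hypothesis turns this sum into a coefficient of X (\<phi>^k)' \<phi>^(n-k), which is k/n times
  that of X (\<phi>^n)'. Keeping the factor n on the left avoids division at n = 0.\<close>

lemma fps_lagrange_inversion:
  fixes f \<phi> :: "'a::field_char_0 fps"
  assumes f: "f = fps_X * (\<phi> oo f)"
  shows "of_nat n * (f ^ k $ n) = of_nat k * (if k \<le> n then \<phi> ^ n $ (n - k) else 0)"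
proof (induction n arbitrary: k rule: less_induct)
  case (less n)
  have Xd: "(fps_X * fps_deriv g) $ j = of_nat j * (g $ j)" for g :: "'a fps" and j
    by (cases j) auto
  have f0: "f $ 0 = 0" by (subst f) simp
  have pow: "f ^ k = fps_X ^ k * (\<phi> ^ k oo f)"
    by (subst f) (simp add: power_mult_distrib fps_compose_power[OF f0])
  consider "k = 0" | "k > n" | "k = n" | "0 < k" "k < n" by linarith
  then show ?case
  proof cases
    case 1
    then show ?thesis by (cases n) auto
  next
    case 2
    then show ?thesis by (simp add: pow fps_X_power_mult_nth)
  next
    case 3
    have "f ^ k $ n = (fps_X ^ k * (\<phi> ^ k oo f)) $ n" by (simp only: pow)
    then show ?thesis using 3 by (simp add: fps_X_power_mult_nth)
  next
    case 4
    define m where "m = n - k"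
    have m: "0 < m" "m < n" "n = m + k" using 4 by (auto simp: m_def)
    have "of_nat m * (f ^ k $ n) = of_nat m * ((\<phi> ^ k oo f) $ m)"
      using 4 by (simp add: pow fps_X_power_mult_nth m_def)
    also have "\<dots> = (\<Sum>j = 0..m. \<phi> ^ k $ j * (of_nat m * (f ^ j $ m)))"
      by (simp add: fps_compose_nth sum_distrib_left mult_ac)
    \<comment> \<open>The induction hypothesis at m trades the m-th coefficient of f^j for one of
      \<phi>^m; the factor j it leaves behind produces a derivative.\<close>
    also have "\<dots> = (\<Sum>j = 0..m. of_nat j * (\<phi> ^ k $ j) * (\<phi> ^ m $ (m - j)))"
      using less.IH[OF m(2)] by (intro sum.cong) (auto simp: mult_ac)
    also have "\<dots> = (fps_X * fps_deriv (\<phi> ^ k) * \<phi> ^ m) $ m"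
      by (simp only: fps_mult_nth[of "fps_X * fps_deriv (\<phi> ^ k)"] Xd)
    also have "fps_X * fps_deriv (\<phi> ^ k) * \<phi> ^ m
        = fps_const (of_nat k) * (fps_X * (fps_deriv \<phi> * \<phi> ^ (n - 1)))"
    proof -
      have "\<phi> ^ (n - 1) = \<phi> ^ (k - 1) * \<phi> ^ m"
        using 4 m by (simp add: add.commute flip: power_add)
      then show ?thesis by (simp add: fps_deriv_power mult_ac)
    qed
    finally have 1: "of_nat m * (f ^ k $ n) = of_nat k * ((fps_X * (fps_deriv \<phi> * \<phi> ^ (n - 1))) $ m)"
      by simp
    have "fps_X * fps_deriv (\<phi> ^ n) = fps_const (of_nat n) * (fps_X * (fps_deriv \<phi> * \<phi> ^ (n - 1)))"
      by (simp add: fps_deriv_power mult_ac)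
    then have 2: "of_nat n * ((fps_X * (fps_deriv \<phi> * \<phi> ^ (n - 1))) $ m) = of_nat m * (\<phi> ^ n $ m)"
      using Xd[of "\<phi> ^ n" m] by (simp only: fps_mult_left_const_nth)
    have "of_nat m * (of_nat n * (f ^ k $ n)) = of_nat n * (of_nat m * (f ^ k $ n))"
      by (rule mult.left_commute)
    also have "\<dots> = of_nat k * (of_nat n * ((fps_X * (fps_deriv \<phi> * \<phi> ^ (n - 1))) $ m))"
      unfolding 1 by (rule mult.left_commute)
    also have "\<dots> = of_nat m * (of_nat k * (\<phi> ^ n $ m))"
      unfolding 2 by (rule mult.left_commute)
    finally have "of_nat n * (f ^ k $ n) = of_nat k * (\<phi> ^ n $ m)"
      using m(1) by (simp only: mult_cancel_left of_nat_eq_0_iff) simp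
    then show ?thesis using 4(2) unfolding m_def by simp
  qed
qed

text \<open>The first component determines i, so the union is disjoint and its cardinality is a
  Cauchy product.\<close>

lemma card_convolution:
  fixes A :: "nat \<Rightarrow> 'b set" and C :: "nat \<Rightarrow> 'c set"
  assumes "\<And>n. finite (A n)" "\<And>n. finite (C n)" "\<And>m n. m \<noteq> n \<Longrightarrow> A m \<inter> A n = {}"
  shows "of_nat (card (\<Union>i \<in> {0..n}. A i \<times> C (n - i)))
    = (Abs_fps (\<lambda>n. of_nat (card (A n))) * Abs_fps (\<lambda>n. of_nat (card (C n))) :: 'a::comm_semiring_1 fps) $ n"
proof -
  have "card (\<Union>i \<in> {0..n}. A i \<times> C (n - i)) = (\<Sum>i = 0..n. card (A i \<times> C (n - i)))"
  proof (intro card_UN_disjoint ballI impI)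
    show "A i \<times> C (n - i) \<inter> A j \<times> C (n - j) = {}" if "i \<noteq> j" for i j
      using assms(3)[OF that] by blast
  qed (use assms in auto)
  then show ?thesis by (simp add: fps_mult_nth card_cartesian_product)
qed

section \<open>A model of the free initial pre-associative algebra on one generator\<close>

definition scal :: "'k::field \<Rightarrow> ('a \<Rightarrow>\<^sub>0 'k) \<Rightarrow> ('a \<Rightarrow>\<^sub>0 'k)" where
  "scal c p = Poly_Mapping.map ((*) c) p"

lemma lookup_scal [simp]: "Poly_Mapping.lookup (scal c p) t = c * Poly_Mapping.lookup p t"
  by (simp add: scal_def Poly_Mapping.map.rep_eq when_def)

text \<open>\<open>free_scale\<close> is confined to trees as basis, while the model has words as
  basis; this identifies the two scalings where both apply.\<close>

lemma scal_free_scale: "scal = free_scale"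
  by (simp add: fun_eq_iff scal_def free_scale_def)

interpretation scal: vector_space scal
  by unfold_locales (auto intro!: poly_mapping_eqI simp: lookup_add algebra_simps)

lemma scal_single [simp]: "scal c (Poly_Mapping.single t a) = Poly_Mapping.single t (c * a)"
  by (rule poly_mapping_eqI) (simp add: lookup_single when_def)

definition linext :: "('a \<Rightarrow> ('b \<Rightarrow>\<^sub>0 'k::field)) \<Rightarrow> ('a \<Rightarrow>\<^sub>0 'k) \<Rightarrow> ('b \<Rightarrow>\<^sub>0 'k)" where
  "linext f p = (\<Sum>t \<in> Poly_Mapping.keys p. scal (Poly_Mapping.lookup p t) (f t))"

lemma linext_superset:
  assumes "finite A" "Poly_Mapping.keys p \<subseteq> A"
  shows "linext f p = (\<Sum>t \<in> A. scal (Poly_Mapping.lookup p t) (f t))"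
  unfolding linext_def using assms
  by (intro sum.mono_neutral_left) (auto simp: in_keys_iff)

lemma linext_zero [simp]: "linext f 0 = 0"
  by (simp add: linext_def)

lemma linext_add: "linext f (p + q) = linext f p + linext f q"
proof -
  let ?A = "Poly_Mapping.keys p \<union> Poly_Mapping.keys q \<union> Poly_Mapping.keys (p + q)"
  show ?thesis
    by (subst (1 2 3) linext_superset[of ?A])
       (auto simp: lookup_add scal.scale_left_distrib sum.distrib)
qed

lemma linext_scal: "linext f (scal c p) = scal c (linext f p)"
proof -
  let ?A = "Poly_Mapping.keys p \<union> Poly_Mapping.keys (scal c p)"
  show ?thesis
    by (subst (1 2) linext_superset[of ?A]) (auto simp: scal.scale_sum_right)
qed

lemma linext_minus: "linext f (- p) = - linext f p"
  using linext_add[of f p "- p"] by (simp add: eq_neg_iff_add_eq_0 add.commute)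

lemma linext_diff: "linext f (p - q) = linext f p - linext f q"
  using linext_add[of f p "- q"] by (simp add: linext_minus)

lemma linext_single: "linext f (Poly_Mapping.single t a) = scal a (f t)"
  by (auto simp: linext_def)

lemma linext_single_1 [simp]: "linext f (Poly_Mapping.single t 1) = f t"
  by (simp add: linext_single)

lemma linext_fun_add: "linext (\<lambda>t. f t + g t) p = linext f p + linext g p"
  by (simp add: linext_def scal.scale_right_distrib sum.distrib)

lemma linext_fun_scal: "linext (\<lambda>t. scal c (f t)) p = scal c (linext f p)"
  by (simp add: linext_def scal.scale_sum_right mult.commute)

lemma keys_linext: "Poly_Mapping.keys (linext f p) \<subseteq> (\<Union>t \<in> Poly_Mapping.keys p. Poly_Mapping.keys (f t))"
proof -
  have "Poly_Mapping.lookup (linext f p) s = 0"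
    if "s \<notin> (\<Union>t \<in> Poly_Mapping.keys p. Poly_Mapping.keys (f t))" for s
    using that by (auto simp: linext_def lookup_sum in_keys_iff)
  then show ?thesis by (meson in_keys_iff subsetI)
qed

lemma linext_cong: "(\<And>t. t \<in> Poly_Mapping.keys p \<Longrightarrow> f t = g t) \<Longrightarrow> linext f p = linext g p"
  by (simp add: linext_def)

lemma basis_induct [case_names single add scal]:
  assumes "\<And>t. Q (Poly_Mapping.single t 1)"
    and "\<And>p q. Q p \<Longrightarrow> Q q \<Longrightarrow> Q (p + q)" "\<And>c p. Q p \<Longrightarrow> Q (scal c p)"
  shows "Q (p :: 'a \<Rightarrow>\<^sub>0 'k::field)"
proof -
  \<comment> \<open>Zero is a zero multiple of a basis vector, so the rule has no case of its own
    for it.\<close>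
  have 0: "Q 0" using assms(3)[OF assms(1), of 0] by simp
  have eq: "p = linext (\<lambda>t. Poly_Mapping.single t 1) p"
  proof (rule poly_mapping_eqI)
    fix s
    have "Poly_Mapping.lookup (linext (\<lambda>t. Poly_Mapping.single t 1) p) s
      = (\<Sum>t \<in> Poly_Mapping.keys p. if t = s then Poly_Mapping.lookup p t else 0)"
      unfolding linext_def lookup_sum
      by (intro sum.cong refl) (auto simp: lookup_single when_def)
    also have "\<dots> = Poly_Mapping.lookup p s" by (simp add: in_keys_iff)
    finally show "Poly_Mapping.lookup p s
      = Poly_Mapping.lookup (linext (\<lambda>t. Poly_Mapping.single t 1) p) s" by simp
  qed
  have "Q (\<Sum>t \<in> A. scal (Poly_Mapping.lookup p t) (Poly_Mapping.single t 1))" if "finite A" for A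
    using that by (induction A rule: finite_induct) (use assms 0 in \<open>auto simp del: scal_single\<close>)
  then show ?thesis by (subst eq) (simp only: linext_def finite_keys)
qed

lemma linext_eqI:
  assumes "\<And>t. F (Poly_Mapping.single t 1) = G (Poly_Mapping.single t 1)"
    and "\<And>p q. F (p + q) = F p + F q" "\<And>c p. F (scal c p) = scal c (F p)"
    and "\<And>p q. G (p + q) = G p + G q" "\<And>c p. G (scal c p) = scal c (G p)"
  shows "F p = G p"
  by (induction p rule: basis_induct) (simp_all only: assms)

text \<open>
  \<open>Gen r\<close> is the word \<open>x r\<close> and \<open>Bra v a r\<close> is the word \<open>[x v, a] r\<close>, where the letter
  \<open>[w, a]\<close> stands for \<open>w \<succ> a\<close>. The letters with \<open>a\<close> empty are junk: the model satisfies the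
  relations on them as well, and they are only excluded when words are counted.
\<close>

datatype word = Emp | Gen word | Bra word word word

text \<open>Multiplication of finitely supported functions convolves along the addition of the index
  type. With concatenation as \<open>+\<close>, the space of functions on words is therefore the
  free associative unital algebra on the letters.\<close>

instantiation word :: monoid_add
begin

definition zero_word :: word where "0 = Emp"

primrec plus_word :: "word \<Rightarrow> word \<Rightarrow> word" where
  "Emp + z = z"
| "Gen r + z = Gen (r + z)"
| "Bra v a r + z = Bra v a (r + z)"

instance
proof
  fix u v w :: word
  show "u + v + w = u + (v + w)" by (induction u) auto
  show "0 + u = u" by (simp add: zero_word_def)
  show "u + 0 = u" by (induction u) (auto simp: zero_word_def)
qed

end

lemma plus_Emp [simp]: "u + Emp = u"
  using add_0_right[of u] by (simp add: zero_word_def)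

text \<open>Counts the generators x in a word, hence the arity. The 1 in the case \<open>Bra\<close>
  is the x at the front of the entry x v of the letter.\<close>

primrec deg :: "word \<Rightarrow> nat" where
  "deg Emp = 0"
| "deg (Gen r) = 1 + deg r"
| "deg (Bra v a r) = 1 + deg v + deg a + deg r"

lemma deg_plus [simp]: "deg (u + z) = deg u + deg z"
  by (induction u) auto

abbreviation sg :: "'a \<Rightarrow> 'a \<Rightarrow>\<^sub>0 'k::field" where
  "sg u \<equiv> Poly_Mapping.single u 1"

lemma sg_mult: "sg u * sg z = sg (u + z)"
  by (simp add: mult_single)

lemma sg_Emp: "sg Emp = 1"
  by (metis single_one zero_word_def)

lemma mult_scal_left: "scal c p * q = scal c (p * (q :: word \<Rightarrow>\<^sub>0 'k::field))"
  by (simp add: scal_def mult_map_scale_conv_mult mult.assoc)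

lemma mult_scal_right: "p * scal c q = scal c (p * (q :: word \<Rightarrow>\<^sub>0 'k::field))"
proof -
  \<comment> \<open>Constants are central, so multiplying by one on the right is scaling
    too.\<close>
  have "p * Poly_Mapping.single 0 c = scal c p"
  proof (induction p rule: basis_induct)
    case (single t)
    show ?case by (simp add: mult_single)
  qed (simp_all add: distrib_right scal.scale_right_distrib mult_scal_left mult.commute)
  then have "p * (Poly_Mapping.single 0 c * q) = scal c p * q"
    by (simp flip: mult.assoc)
  then show ?thesis
    unfolding mult_scal_left by (simp add: scal_def mult_map_scale_conv_mult)
qed

text \<open>The operation (x v) \<succ> _ of the model, as \<open>succ_Gen\<close> confirms. It
  vanishes on the unit, in accordance with x \<prec> 1 = x and x \<succ> 1 = 0, so it never creates
  the junk letter [x v, 1].\<close>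

definition bracket :: "word \<Rightarrow> (word \<Rightarrow>\<^sub>0 'k::field) \<Rightarrow> (word \<Rightarrow>\<^sub>0 'k)" where
  "bracket v = linext (\<lambda>t. if t = Emp then 0 else sg (Bra v t Emp))"

section \<open>The two operations on words\<close>

text \<open>
  On the empty word, which is the unit of the concatenation product, \<open>1 \<prec> z = 0\<close>. The test on
  \<open>deg t\<close> always succeeds; it only makes termination of the nested recursion evident.
\<close>

function prec_word :: "word \<Rightarrow> word \<Rightarrow> (word \<Rightarrow>\<^sub>0 'k::field)" where
  "prec_word Emp z = 0"
| "prec_word (Gen r) z = sg (Gen (r + z)) - bracket r (sg z)"
| "prec_word (Bra v a r) z = sg (Bra v a Emp) * prec_word r z - bracket v (linext (\<lambda>t. prec_word a t) (prec_word r z))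
     + bracket v (linext (\<lambda>t. prec_word (if deg t \<le> deg a + deg r then t else Emp) z) (prec_word a r))"
  by pat_completeness auto
termination by (relation "measure (\<lambda>(u, z). deg u)") auto

definition prec :: "(word \<Rightarrow>\<^sub>0 'k::field) \<Rightarrow> (word \<Rightarrow>\<^sub>0 'k) \<Rightarrow> (word \<Rightarrow>\<^sub>0 'k)" where
  "prec p q = linext (\<lambda>u. linext (prec_word u) q) p"

text \<open>With the sum of the operations equal to concatenation, associativity is automatic. The
  first relation then follows from the second, which is what remains to be proved.\<close>

definition succ :: "(word \<Rightarrow>\<^sub>0 'k::field) \<Rightarrow> (word \<Rightarrow>\<^sub>0 'k) \<Rightarrow> (word \<Rightarrow>\<^sub>0 'k)" where
  "succ p q = p * q - prec p q"

lemma bracket_add: "bracket v (p + q) = bracket v p + bracket v q"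
  and bracket_diff: "bracket v (p - q) = bracket v p - bracket v q"
  and bracket_scal: "bracket v (scal c p) = scal c (bracket v p)"
  and bracket_zero: "bracket v 0 = 0"
  and bracket_minus: "bracket v (- p) = - bracket v p"
  and bracket_sg: "bracket v (sg t) = (if t = Emp then 0 else sg (Bra v t Emp))"
  by (simp_all add: bracket_def linext_add linext_diff linext_scal linext_minus)

lemma prec_add_left: "prec (p + p') q = prec p q + prec p' q"
  and prec_diff_left: "prec (p - p') q = prec p q - prec p' q"
  and prec_scal_left: "prec (scal c p) q = scal c (prec p q)"
  by (simp_all add: prec_def linext_add linext_diff linext_scal)

lemma prec_add_right: "prec p (q + q') = prec p q + prec p q'"
  and prec_scal_right: "prec p (scal c q) = scal c (prec p q)"
  by (simp_all add: prec_def linext_add linext_scal linext_fun_add linext_fun_scal)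

lemma prec_diff_right: "prec p (q - q') = prec p q - prec p q'"
  using prec_add_right[of p "q - q'" q'] by (simp add: algebra_simps)

lemma prec_zero [simp]: "prec p 0 = 0" "prec 0 p = 0"
  using prec_diff_right[of p 0 0] by (simp, simp add: prec_def)

lemma prec_sg: "prec (sg u) (sg z) = prec_word u z"
  by (simp add: prec_def)

lemmas bil = prec_add_left prec_diff_left prec_scal_left prec_add_right prec_diff_right prec_scal_right
  bracket_add bracket_diff bracket_scal bracket_zero bracket_minus mult_scal_left mult_scal_right scal.scale_right_distrib
  scal.scale_right_diff_distrib

lemma keys_sg [simp]: "Poly_Mapping.keys (sg u :: _ \<Rightarrow>\<^sub>0 'k::field) = {u}"
  by simp

lemma keys_times:
  "Poly_Mapping.keys (p * q) \<subseteq> {u + z |u z. u \<in> Poly_Mapping.keys p \<and> z \<in> Poly_Mapping.keys q}"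
  for p q :: "word \<Rightarrow>\<^sub>0 'k::field"
  by (rule keys_mult)

lemma deg_bracket: "t \<in> Poly_Mapping.keys (bracket v p) \<Longrightarrow> \<exists>s \<in> Poly_Mapping.keys p. deg t = 1 + deg v + deg s"
  using keys_linext[of "\<lambda>t. if t = Emp then 0 else sg (Bra v t Emp)" p]
  unfolding bracket_def[symmetric] by (fastforce split: if_splits)

text \<open>This bound shows that the test in \<open>prec_word\<close> succeeds, and it lets later
  inductions on the degree reach all words occurring in a product.\<close>

lemma deg_prec_word: "t \<in> Poly_Mapping.keys (prec_word u z :: word \<Rightarrow>\<^sub>0 'k::field) \<Longrightarrow> deg t \<le> deg u + deg z"
proof (induction u z arbitrary: t rule: prec_word.induct)
  case (2 r z)
  then have "t \<in> Poly_Mapping.keys (sg (Gen (r + z)) :: word \<Rightarrow>\<^sub>0 'k)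
     \<union> Poly_Mapping.keys (bracket r (sg z) :: word \<Rightarrow>\<^sub>0 'k)"
    using keys_diff by fastforce
  then show ?case using deg_bracket[of t r "sg z :: word \<Rightarrow>\<^sub>0 'k"] by auto
next
  case (3 v a r z)
  have IH: "s \<in> Poly_Mapping.keys (prec_word r z :: word \<Rightarrow>\<^sub>0 'k) \<Longrightarrow> deg s \<le> deg r + deg z"
    "s \<in> Poly_Mapping.keys (prec_word a w :: word \<Rightarrow>\<^sub>0 'k) \<Longrightarrow> deg s \<le> deg a + deg w"
    "s \<in> Poly_Mapping.keys (prec_word (if deg w \<le> deg a + deg r then w else Emp) z :: word \<Rightarrow>\<^sub>0 'k)
      \<Longrightarrow> deg s \<le> deg (if deg w \<le> deg a + deg r then w else Emp) + deg z" for s w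
    using "3.IH" by blast+
  let ?X = "sg (Bra v a Emp) * prec_word r z :: word \<Rightarrow>\<^sub>0 'k"
  let ?Y = "linext (prec_word a) (prec_word r z) :: word \<Rightarrow>\<^sub>0 'k"
  let ?Z = "linext (\<lambda>t. prec_word (if deg t \<le> deg a + deg r then t else Emp) z) (prec_word a r) :: word \<Rightarrow>\<^sub>0 'k"
  have "t \<in> Poly_Mapping.keys ?X \<union> Poly_Mapping.keys (bracket v ?Y) \<union> Poly_Mapping.keys (bracket v ?Z)"
    using "3.prems" keys_add[of "?X - bracket v ?Y" "bracket v ?Z"] keys_diff[of ?X "bracket v ?Y"]
    unfolding prec_word.simps by blast
  then consider "t \<in> Poly_Mapping.keys ?X" | "t \<in> Poly_Mapping.keys (bracket v ?Y)"
    | "t \<in> Poly_Mapping.keys (bracket v ?Z)" by blast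
  then show ?case
  proof cases
    case 1
    then obtain s where "s \<in> Poly_Mapping.keys (prec_word r z :: word \<Rightarrow>\<^sub>0 'k)" "t = Bra v a Emp + s"
      using subsetD[OF keys_times, of t "sg (Bra v a Emp)" "prec_word r z :: word \<Rightarrow>\<^sub>0 'k"] by auto
    then show ?thesis using IH(1)[of s] by simp
  next
    case 2
    then obtain s where s: "s \<in> Poly_Mapping.keys ?Y" "deg t = 1 + deg v + deg s"
      using deg_bracket by blast
    then obtain w where "w \<in> Poly_Mapping.keys (prec_word r z :: word \<Rightarrow>\<^sub>0 'k)"
      "s \<in> Poly_Mapping.keys (prec_word a w :: word \<Rightarrow>\<^sub>0 'k)"
      using subsetD[OF keys_linext s(1)] by blast
    then have "deg w \<le> deg r + deg z" "deg s \<le> deg a + deg w" using IH(1,2) by blast+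
    then show ?thesis using s(2) by simp
  next
    case c: 3
    then obtain s where s: "s \<in> Poly_Mapping.keys ?Z" "deg t = 1 + deg v + deg s"
      using deg_bracket by blast
    then obtain w where "s \<in> Poly_Mapping.keys (prec_word (if deg w \<le> deg a + deg r then w else Emp) z :: word \<Rightarrow>\<^sub>0 'k)"
      using subsetD[OF keys_linext s(1)] by blast
    \<comment> \<open>Either outcome of the test yields a left factor of degree at most
      \<open>deg a + deg r\<close>, so the bound does not presuppose that the test succeeds.\<close>
    from IH(3)[OF this] have "deg s \<le> deg a + deg r + deg z" by (auto split: if_splits)
    then show ?thesis using s(2) by simp
  qed
qed auto

declare prec_word.simps(3) [simp del]

lemma prec_word_Bra: "prec_word (Bra v a r) z = sg (Bra v a Emp) * prec_word r z - bracket v (prec (sg a) (prec_word r z))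
    + bracket v (prec (prec_word a r) (sg z) :: word \<Rightarrow>\<^sub>0 'k::field)"
proof -
  have "linext (\<lambda>t. prec_word (if deg t \<le> deg a + deg r then t else Emp) z) (prec_word a r)
      = linext (\<lambda>t. prec_word t z) (prec_word a r :: word \<Rightarrow>\<^sub>0 'k)"
    by (rule linext_cong) (auto dest: deg_prec_word)
  then show ?thesis by (simp add: prec_def prec_word.simps(3))
qed

lemma prec_one_left [simp]: "prec 1 q = 0"
  by (rule linext_eqI[of "prec 1" "\<lambda>_. 0"]) (auto simp: bil prec_sg simp flip: sg_Emp)

lemma prec_Gen: "prec (sg (Gen r)) q = sg (Gen r) * q - bracket r q"
  by (rule linext_eqI[of "prec (sg (Gen r))"]) (auto simp: bil prec_sg sg_mult algebra_simps)

lemma prec_Bra: "prec (sg (Bra v a r)) q = sg (Bra v a Emp) * prec (sg r) q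
    - bracket v (prec (sg a) (prec (sg r) q) - prec (prec (sg a) (sg r)) q)"
  by (rule linext_eqI[of "prec (sg (Bra v a r))"]) (auto simp: bil prec_sg prec_word_Bra algebra_simps)

text \<open>For r empty, \<open>sg r\<close> is the unit and only the last term of
  \<open>prec_Bra\<close> survives; this is the origin of \<open>prec p 1\<close>.
  \<open>prec_bracket\<close> removes it once \<open>prec_one_prec\<close> is known.\<close>

lemma prec_bracket': "prec (bracket v p) q = bracket v (prec (prec p 1) q)"
  by (rule linext_eqI[of "\<lambda>p. prec (bracket v p) q"])
    (auto simp: bil bracket_sg prec_Bra sg_Emp)

lemma deg_prec:
  assumes "t \<in> Poly_Mapping.keys (prec p (q :: word \<Rightarrow>\<^sub>0 'k::field))"
  shows "\<exists>u \<in> Poly_Mapping.keys p. \<exists>z \<in> Poly_Mapping.keys q. deg t \<le> deg u + deg z"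
proof -
  obtain u where u: "u \<in> Poly_Mapping.keys p" "t \<in> Poly_Mapping.keys (linext (prec_word u) q)"
    using subsetD[OF keys_linext assms[unfolded prec_def]] by blast
  obtain z where "z \<in> Poly_Mapping.keys q" "t \<in> Poly_Mapping.keys (prec_word u z :: word \<Rightarrow>\<^sub>0 'k)"
    using subsetD[OF keys_linext u(2)] by blast
  with u(1) show ?thesis using deg_prec_word by blast
qed

lemma bracket_mult_prec: "prec (sg (Bra v a Emp) * p) q = sg (Bra v a Emp) * prec p q
    - bracket v (prec (sg a) (prec p q) - prec (prec (sg a) p) q)"
proof (rule linext_eqI[of "\<lambda>p. prec (sg (Bra v a Emp) * p) q"])
  show "prec (sg (Bra v a Emp) * sg t) q = sg (Bra v a Emp) * prec (sg t) q
    - bracket v (prec (sg a) (prec (sg t) q) - prec (prec (sg a) (sg t)) q)" for t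
    unfolding sg_mult prec_Bra[symmetric] by simp
qed (simp_all add: bil distrib_left)

lemma keys_prec_deg_le:
  assumes "\<And>u. u \<in> Poly_Mapping.keys p \<Longrightarrow> deg u \<le> m" "\<And>z. z \<in> Poly_Mapping.keys q \<Longrightarrow> deg z \<le> n"
    and "t \<in> Poly_Mapping.keys (prec p (q :: word \<Rightarrow>\<^sub>0 'k::field))"
  shows "deg t \<le> m + n"
  using deg_prec[OF assms(3)] assms(1,2) by (meson add_mono order_trans)

text \<open>Agreement is asked only on the words occurring in p, so an induction hypothesis limited
  by degree can be applied to a linear combination.\<close>

lemma linear_on_keys:
  assumes "\<And>t. t \<in> Poly_Mapping.keys p \<Longrightarrow> F (sg t) = G (sg t)"
    and F: "\<And>p q. F (p + q) = F p + F q" "\<And>c p. F (scal c p) = scal c (F p)"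
    and G: "\<And>p q. G (p + q) = G p + G q" "\<And>c p. G (scal c p) = scal c (G p)"
  shows "F p = G p"
proof -
  have "F p = linext (\<lambda>t. F (sg t)) p"
    by (rule linext_eqI[of F]) (simp_all add: F linext_add linext_scal)
  also have "\<dots> = linext (\<lambda>t. G (sg t)) p"
    by (rule linext_cong) (rule assms(1))
  also have "\<dots> = G p"
    by (rule linext_eqI[of _ G]) (simp_all add: G linext_add linext_scal)
  finally show ?thesis .
qed

section \<open>The second relation in the model\<close>

text \<open>The identity \<open>p \<prec> 1 = p\<close> itself fails for \<open>p = 1\<close> and for junk words.\<close>

lemma prec_one_prec: "prec (prec p 1) q = prec p q"
proof -
  \<comment> \<open>The induction runs on a bound n because the hypothesis is applied to whole
    combinations of words, whose degrees are known only up to a bound.\<close>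
  have "prec (prec (sg u) 1) q = prec (sg u) q" if "deg u \<le> n" for n u and q :: "word \<Rightarrow>\<^sub>0 'k::field"
    using that
  proof (induction n arbitrary: u q)
    case 0
    then show ?case by (cases u) (auto simp: sg_Emp)
  next
    case (Suc n)
    have vec: "prec (prec p 1) q = prec p q"
      if "\<And>t. t \<in> Poly_Mapping.keys p \<Longrightarrow> deg t \<le> n" for p q :: "word \<Rightarrow>\<^sub>0 'k::field"
      by (rule linear_on_keys[of p "\<lambda>p. prec (prec p 1) q"])
        (simp_all only: that Suc.IH prec_add_left prec_scal_left)
    show ?case
    proof (cases u)
      case Emp then show ?thesis by (simp add: sg_Emp)
    next
      case (Gen r)
      have "bracket r 1 = (0 :: word \<Rightarrow>\<^sub>0 'k)" by (simp add: bracket_sg flip: sg_Emp)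
      then show ?thesis using Gen by (simp add: prec_Gen)
    next
      case (Bra v a r)
      have d: "deg a + deg r \<le> n" using Bra Suc.prems by simp
      have r: "prec (prec (sg r) 1) q = prec (sg r) q" for q :: "word \<Rightarrow>\<^sub>0 'k"
        using d by (intro Suc.IH) simp
      have deg1: "deg t \<le> deg r" if "t \<in> Poly_Mapping.keys (prec (sg r) 1 :: word \<Rightarrow>\<^sub>0 'k)" for t
        using keys_prec_deg_le[OF _ _ that, of "deg r" 0] by (simp add: keys_one zero_word_def)
      have deg2: "deg t \<le> deg a + deg r"
        if "t \<in> Poly_Mapping.keys (prec (sg a) (sg r) :: word \<Rightarrow>\<^sub>0 'k)" for t
        using keys_prec_deg_le[OF _ _ that, of "deg a" "deg r"] by simp
      have deg3: "deg t \<le> deg a + deg r"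
        if "t \<in> Poly_Mapping.keys (prec (sg a) (prec (sg r) 1) :: word \<Rightarrow>\<^sub>0 'k)" for t
        using keys_prec_deg_le[OF _ _ that, of "deg a" "deg r"] deg1 by simp
      have "prec (prec (prec (sg a) (prec (sg r) 1)) 1) q = prec (prec (sg a) (prec (sg r) 1)) q"
        by (rule vec) (use deg3 d in force)
      moreover have v: "prec (prec (prec (sg a) (sg r)) 1) q = prec (prec (sg a) (sg r)) q" for q :: "word \<Rightarrow>\<^sub>0 'k"
        by (rule vec) (use deg2 d in force)
      \<comment> \<open>After expansion, the terms in \<open>prec (sg a) (prec (sg r) 1)\<close>
        occur with both signs and cancel.\<close>
      ultimately show ?thesis
        unfolding Bra prec_Bra[of v a r] prec_diff_left[of "sg (Bra v a Emp) * _"] bracket_mult_prec prec_bracket'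
        by (simp only: r prec_diff_left bracket_diff v diff_diff_eq2 diff_add_eq diff_diff_eq) (simp add: algebra_simps)
    qed
  qed
  from this[OF order_refl] show ?thesis
    by (rule linext_eqI[of "\<lambda>p. prec (prec p 1) q" "\<lambda>p. prec p q"])
      (simp_all only: prec_add_left prec_scal_left)
qed

text \<open>This is the second relation for a left factor x v, the case \<open>Gen\<close> of
  \<open>prec_succ_sg\<close>.\<close>

lemma prec_bracket: "prec (bracket v p) q = bracket v (prec p q)"
  by (simp add: prec_bracket' prec_one_prec)

lemma succ_diff_right: "succ p (q - q') = succ p q - succ p q'"
  by (simp add: succ_def prec_diff_right right_diff_distrib)

lemma succ_Gen: "succ (sg (Gen r)) q = bracket r q"
  by (simp add: succ_def prec_Gen)

text \<open>In the model the rewriting rule of the overview holds by construction: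
  \<open>prec_word\<close> was defined as what it leaves of the product.\<close>

lemma succ_Bra: "succ (sg (Bra v a r)) (q :: word \<Rightarrow>\<^sub>0 'k::field) = sg (Bra v a Emp) * succ (sg r) q
    + bracket v (prec (sg a) (prec (sg r) q) - prec (prec (sg a) (sg r)) q)"
proof -
  have "sg (Bra v a r) * q = sg (Bra v a Emp) * (sg r * q)"
    unfolding mult.assoc[symmetric] sg_mult by simp
  then show ?thesis
    unfolding succ_def prec_Bra[of v a r] by (simp add: right_diff_distrib)
qed

text \<open>Induction on the degree of the left factor. For the word [x v, a] r, the hypotheses come
  from the three smaller words a, r and a r.\<close>

lemma prec_succ_sg: "prec (succ (sg u) q) (s :: word \<Rightarrow>\<^sub>0 'k::field) = succ (sg u) (prec q s)"
proof (induction "deg u" arbitrary: u q s rule: less_induct)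
  case less
  show ?case
  proof (cases u)
    case Emp
    then show ?thesis by (simp add: succ_def sg_Emp)
  next
    case (Gen r)
    then show ?thesis by (simp add: succ_Gen prec_bracket)
  next
    case (Bra v a r)
    let ?a = "sg a :: word \<Rightarrow>\<^sub>0 'k" and ?r = "sg r :: word \<Rightarrow>\<^sub>0 'k"
    have Ta: "prec (succ ?a q) s = succ ?a (prec q s)" for q s
      by (rule less) (simp add: Bra)
    have Tr: "prec (succ ?r q) s = succ ?r (prec q s)" for q s
      by (rule less) (simp add: Bra)
    have Tar: "prec (succ (?a * ?r) q) s = succ (?a * ?r) (prec q s)" for q s
      unfolding sg_mult by (rule less) (simp add: Bra)
    \<comment> \<open>By the second form of this expression, applying \<open>\<prec> s\<close> to it amounts to replacing \<open>q\<close> by \<open>q \<prec> s\<close>.\<close>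
    have alpha: "prec ?a (?r * q) - prec (prec ?a ?r) q = succ (?a * ?r) q - succ ?a (succ ?r q)" for q
    proof -
      have "prec (?a * ?r) q = prec (prec ?a ?r) q + prec (succ ?a ?r) q"
        by (simp add: succ_def prec_diff_left)
      also have "prec (succ ?a ?r) q = ?a * prec ?r q - prec ?a (prec ?r q)"
        unfolding Ta by (simp only: succ_def)
      finally show ?thesis
        by (simp add: succ_def right_diff_distrib prec_diff_right mult.assoc)
    qed
    have "prec (prec ?a (?r * q) - prec (prec ?a ?r) q) s
        = prec ?a (?r * prec q s) - prec (prec ?a ?r) (prec q s)"
      unfolding alpha prec_diff_left Tar Ta Tr ..
    moreover have "?r * prec q s = succ ?r (prec q s) + prec ?r (prec q s)"
      "?r * q = succ ?r q + prec ?r q"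
      by (simp_all add: succ_def)
    \<comment> \<open>The two terms with \<open>succ ?r\<close> are what
      \<open>bracket_mult_prec\<close> subtracts when applied to the first summand of
      \<open>succ_Bra\<close>, so they cancel in the end.\<close>
    ultimately have "prec (prec ?a (prec ?r q) - prec (prec ?a ?r) q) s
       = prec ?a (succ ?r (prec q s)) + prec ?a (prec ?r (prec q s)) - prec (prec ?a ?r) (prec q s)
         - prec (prec ?a (succ ?r q)) s"
      by (simp add: prec_add_right prec_add_left prec_diff_left algebra_simps)
    then show ?thesis
      unfolding Bra succ_Bra prec_add_left bracket_mult_prec prec_bracket Tr
      by (simp add: bracket_add bracket_diff)
  qed
qed

lemma succ_add_left: "succ (p + p') q = succ p q + succ p' q"
  and succ_add_right: "succ p (q + q') = succ p q + succ p q'"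
  and succ_scal_left: "succ (scal c p) q = scal c (succ p q)"
  and succ_scal_right: "succ p (scal c q) = scal c (succ p q)"
  by (simp_all add: succ_def bil distrib_left distrib_right)

lemma prec_succ: "prec (succ p q) s = succ p (prec q s)"
  by (rule linext_eqI[of "\<lambda>p. prec (succ p q) s"])
    (simp_all only: prec_succ_sg succ_add_left succ_scal_left prec_add_left prec_scal_left)

section \<open>Evaluating trees in the model\<close>

primrec model_op :: "pre_op \<Rightarrow> (word \<Rightarrow>\<^sub>0 'k::field) \<Rightarrow> (word \<Rightarrow>\<^sub>0 'k) \<Rightarrow> (word \<Rightarrow>\<^sub>0 'k)" where
  "model_op Prec = prec"
| "model_op Succ = succ"

lemma model_op_add_left: "model_op g (p + p') q = model_op g p q + model_op g p' q"
  and model_op_add_right: "model_op g p (q + q') = model_op g p q + model_op g p q'"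
  and model_op_scal_left: "model_op g (scal c p) q = scal c (model_op g p q)"
  and model_op_scal_right: "model_op g p (scal c q) = scal c (model_op g p q)"
  by (cases g; simp add: prec_add_left prec_add_right prec_scal_left prec_scal_right
      succ_add_left succ_add_right succ_scal_left succ_scal_right)+

text \<open>In the end every leaf carries the generator, but composition puts composite values at
  single leaves, so the values must be able to differ from leaf to leaf.\<close>

primrec tree_val :: "pre_op tree \<Rightarrow> (nat \<Rightarrow> (word \<Rightarrow>\<^sub>0 'k::field)) \<Rightarrow> (word \<Rightarrow>\<^sub>0 'k)" where
  "tree_val \<langle>\<rangle> \<sigma> = \<sigma> 1"
| "tree_val \<langle>l, g, r\<rangle> \<sigma> = model_op g (tree_val l \<sigma>) (tree_val r (\<lambda>j. \<sigma> (j + size1 l)))"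

lemma tree_val_cong: "(\<And>j. 1 \<le> j \<Longrightarrow> j \<le> size1 t \<Longrightarrow> \<sigma> j = \<sigma>' j) \<Longrightarrow> tree_val t \<sigma> = tree_val t \<sigma>'"
proof (induction t arbitrary: \<sigma> \<sigma>')
  case (Node l g r)
  have "tree_val l \<sigma> = tree_val l \<sigma>'" by (rule Node.IH) (simp add: Node.prems)
  moreover have "tree_val r (\<lambda>j. \<sigma> (j + size1 l)) = tree_val r (\<lambda>j. \<sigma>' (j + size1 l))"
    by (rule Node.IH) (simp add: Node.prems)
  ultimately show ?case by simp
qed auto

text \<open>
  The values at the leaves other than \<open>i\<close> of a tree whose leaf \<open>i\<close> gets replaced by a tree with
  \<open>m\<close> leaves, in terms of the values at the leaves of the result.
\<close>

definition spread :: "nat \<Rightarrow> nat \<Rightarrow> (nat \<Rightarrow> 'a) \<Rightarrow> nat \<Rightarrow> 'a" where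
  "spread i m \<sigma> j = (if j < i then \<sigma> j else \<sigma> (j + m - 1))"

text \<open>Grafting corresponds to substitution. The leaves of s take the positions from i to i +
  \<open>size1 s\<close> - 1, whence the shift by i - 1 for s and by \<open>size1 s\<close> - 1 for
  the later leaves of t.\<close>

lemma tree_val_graft:
  assumes "1 \<le> i" "i \<le> size1 t"
  shows "tree_val (graft t i s) \<sigma> = tree_val t ((spread i (size1 s) \<sigma>)(i := tree_val s (\<lambda>j. \<sigma> (j + (i - 1)))))"
  using assms
proof (induction t arbitrary: i \<sigma>)
  case Leaf
  then show ?case by simp
next
  case (Node l g r)
  show ?case
  proof (cases "i \<le> size1 l")
    case True
    have "tree_val (graft l i s) \<sigma>
        = tree_val l ((spread i (size1 s) \<sigma>)(i := tree_val s (\<lambda>j. \<sigma> (j + (i - 1)))))"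
      using Node True by blast
    moreover have "tree_val r (\<lambda>j. \<sigma> (j + size1 (graft l i s)))
       = tree_val r (\<lambda>j. ((spread i (size1 s) \<sigma>)(i := tree_val s (\<lambda>j. \<sigma> (j + (i - 1))))) (j + size1 l))"
    proof (rule tree_val_cong)
      fix j :: nat assume "1 \<le> j"
      moreover have "j + size1 (graft l i s) = j + size1 l + size1 s - 1"
        using size1_graft[of i l s] Node.prems True size1_ge0[of s] by simp
      ultimately show "\<sigma> (j + size1 (graft l i s))
         = ((spread i (size1 s) \<sigma>)(i := tree_val s (\<lambda>j. \<sigma> (j + (i - 1))))) (j + size1 l)"
        using True by (simp add: spread_def)
    qed
    ultimately show ?thesis using True by (simp add: fun_upd_def)
  next
    case False
    let ?i = "i - size1 l" and ?\<sigma> = "\<lambda>j. \<sigma> (j + size1 l)"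
    have "tree_val l \<sigma> = tree_val l ((spread i (size1 s) \<sigma>)(i := tree_val s (\<lambda>j. \<sigma> (j + (i - 1)))))"
      using False by (intro tree_val_cong) (simp add: spread_def)
    moreover have "tree_val (graft r ?i s) ?\<sigma>
        = tree_val r ((spread ?i (size1 s) ?\<sigma>)(?i := tree_val s (\<lambda>j. ?\<sigma> (j + (?i - 1)))))"
      using Node.prems False by (intro Node.IH) auto
    moreover have "\<dots> = tree_val r (\<lambda>j. ((spread i (size1 s) \<sigma>)(i := tree_val s (\<lambda>j. \<sigma> (j + (i - 1))))) (j + size1 l))"
    proof (rule tree_val_cong)
      fix j :: nat assume j: "1 \<le> j"
      have "?\<sigma> (j + (?i - 1)) = \<sigma> (j + (i - 1))" for j
        using False by simp
      moreover have "spread ?i (size1 s) ?\<sigma> j = spread i (size1 s) \<sigma> (j + size1 l)"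
        using j False by (auto simp: spread_def less_diff_conv intro!: arg_cong[of _ _ \<sigma>])
      ultimately show "((spread ?i (size1 s) ?\<sigma>)(?i := tree_val s (\<lambda>j. ?\<sigma> (j + (?i - 1))))) j
         = ((spread i (size1 s) \<sigma>)(i := tree_val s (\<lambda>j. \<sigma> (j + (i - 1))))) (j + size1 l)"
        using False by auto
    qed
    ultimately show ?thesis using False by (simp add: fun_upd_def)
  qed
qed

text \<open>Each leaf lies in exactly one subtree and the operations are bilinear. In particular, a
  zero at one leaf makes the whole value zero.\<close>

lemma tree_val_upd_lin:
  assumes "1 \<le> i" "i \<le> size1 t"
  shows "tree_val t (\<sigma>(i := x + y)) = tree_val t (\<sigma>(i := x)) + tree_val t (\<sigma>(i := y))"
    and "tree_val t (\<sigma>(i := scal c x)) = scal c (tree_val t (\<sigma>(i := x)))"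
  using assms
proof (induction t arbitrary: i \<sigma>)
  case Leaf
  { case 1 then show ?case by simp }
  { case 2 then show ?case by simp }
next
  case (Node l g r)
  have l: "tree_val r (\<lambda>j. (\<sigma>(i := z)) (j + size1 l)) = tree_val r (\<lambda>j. \<sigma> (j + size1 l))"
    if "i \<le> size1 l" for z i and \<sigma> :: "nat \<Rightarrow> word \<Rightarrow>\<^sub>0 'a"
    using that by (intro tree_val_cong) auto
  have r1: "tree_val l (\<sigma>(i := z)) = tree_val l \<sigma>" if "\<not> i \<le> size1 l" for z i and \<sigma> :: "nat \<Rightarrow> word \<Rightarrow>\<^sub>0 'a"
    using that by (intro tree_val_cong) auto
  have r2: "(\<lambda>j. (\<sigma>(i := z)) (j + size1 l)) = (\<lambda>j. \<sigma> (j + size1 l))(i - size1 l := z)"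
    if "\<not> i \<le> size1 l" for z i and \<sigma> :: "nat \<Rightarrow> word \<Rightarrow>\<^sub>0 'a"
    using that by (auto simp: fun_eq_iff)
  have ir: "1 \<le> i - size1 l" "i - size1 l \<le> size1 r" if "\<not> i \<le> size1 l" "i \<le> size1 \<langle>l, g, r\<rangle>" for i
    using that by auto
  { case 1
    show ?case
      by (cases "i \<le> size1 l")
        (simp_all only: tree_val.simps l r1 r2 ir Node.IH 1 model_op_add_left model_op_add_right not_False_eq_True)
  }
  { case 2
    show ?case
      by (cases "i \<le> size1 l")
        (simp_all only: tree_val.simps l r1 r2 ir Node.IH 2 model_op_scal_left model_op_scal_right not_False_eq_True)
  }
qed

definition poly_val :: "(nat \<Rightarrow> (word \<Rightarrow>\<^sub>0 'k::field)) \<Rightarrow> (pre_op tree \<Rightarrow>\<^sub>0 'k) \<Rightarrow> (word \<Rightarrow>\<^sub>0 'k)" where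
  "poly_val \<sigma> = linext (\<lambda>t. tree_val t \<sigma>)"

lemma poly_val_add: "poly_val \<sigma> (p + q) = poly_val \<sigma> p + poly_val \<sigma> q"
  and poly_val_diff: "poly_val \<sigma> (p - q) = poly_val \<sigma> p - poly_val \<sigma> q"
  and poly_val_scale: "poly_val \<sigma> (free_scale c p) = scal c (poly_val \<sigma> p)"
  and poly_val_zero [simp]: "poly_val \<sigma> 0 = 0"
  and poly_val_of_tree: "poly_val \<sigma> (of_tree t) = tree_val t \<sigma>"
  by (simp_all add: poly_val_def linext_add linext_diff linext_scal of_tree_def flip: scal_free_scale)

lemma poly_val_circ_tree_right:
  assumes "p \<in> free_component m" "1 \<le> i" "i \<le> m"
  shows "poly_val \<sigma> (free_circ p i (of_tree s))
     = poly_val ((spread i (size1 s) \<sigma>)(i := tree_val s (\<lambda>j. \<sigma> (j + (i - 1))))) p"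
  using assms(1)
proof (induction rule: free_component_induct)
  case (of_tree t)
  then show ?case using assms by (simp add: free_circ_of_tree poly_val_of_tree tree_val_graft fun_upd_def)
qed (simp_all add: free_circ_add_left free_circ_scale_left poly_val_add poly_val_scale)

lemma poly_val_circ_tree_left:
  assumes "q \<in> free_component n" "1 \<le> i" "i \<le> size1 t"
  shows "poly_val \<sigma> (free_circ (of_tree t) i q)
     = tree_val t ((spread i n \<sigma>)(i := poly_val (\<lambda>j. \<sigma> (j + (i - 1))) q))"
  using assms(1)
proof (induction rule: free_component_induct)
  case (of_tree s)
  then show ?case using assms by (simp add: free_circ_of_tree poly_val_of_tree tree_val_graft fun_upd_def)
next
  case zero
  show ?case using tree_val_upd_lin(2)[OF assms(2,3), where c = 0 and x = 0 and \<sigma> = "spread i n \<sigma>"] by (simp add: fun_upd_def)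
next
  case (add p q)
  then show ?case unfolding free_circ_add_right poly_val_add tree_val_upd_lin(1)[OF assms(2,3)] by (rule arg_cong2)
next
  case (scale c p)
  then show ?case unfolding free_circ_scale_right poly_val_scale tree_val_upd_lin(2)[OF assms(2,3)] by (rule arg_cong)
qed

text \<open>Quantifying over all assignments makes the induction work: composing an ideal element
  with trees merely changes its assignment, and plugging it into a tree puts zero at one
  leaf.\<close>

lemma poly_val_ideal:
  "free_ideal preAsI_relators n p \<Longrightarrow> poly_val \<sigma> p = 0"
proof (induction arbitrary: \<sigma> rule: free_ideal.induct)
  case (generator r n)
  \<comment> \<open>Associativity of \<open>*\<close>, with \<open>prec_succ\<close> applied to the
    mixed term, is the first relation.\<close>
  have assoc: "succ (succ x y) z + succ (prec x y) z - succ x (succ y z) + prec (prec x y) z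
      - prec x (succ y z) - prec x (prec y z) = 0" for x y z :: "word \<Rightarrow>\<^sub>0 'a"
  proof -
    have "succ (succ x y) z + succ (prec x y) z = succ (x * y) z"
      unfolding succ_add_left[symmetric] by (simp add: succ_def[of x y])
    moreover have "\<dots> = x * y * z - prec (x * y) z" by (simp add: succ_def)
    moreover have "prec x (succ y z) + prec x (prec y z) = prec x (y * z)"
      unfolding prec_add_right[symmetric] by (simp add: succ_def[of y z])
    moreover have "succ x (succ y z) = x * y * z - prec x (y * z) - prec (succ x y) z"
      unfolding prec_succ by (simp add: succ_def[of y z] succ_diff_right, simp add: succ_def mult.assoc)
    moreover have "prec (succ x y) z = prec (x * y) z - prec (prec x y) z"
      by (simp add: succ_def prec_diff_left)
    ultimately have "(succ (succ x y) z + succ (prec x y) z) - succ x (succ y z) + prec (prec x y) z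
      - (prec x (succ y z) + prec x (prec y z)) = 0"
      by (simp only:) simp
    then show ?thesis by (simp add: algebra_simps)
  qed
  from generator(1) show ?case
    unfolding preAsI_relators_def
    by (auto simp: poly_val_add poly_val_diff poly_val_of_tree assoc prec_succ)
next
  case (circ_left m p q n i)
  from circ_left(2) show ?case
  proof (induction rule: free_component_induct)
    case (of_tree s)
    then show ?case
      using poly_val_circ_tree_right[OF free_ideal_in_component[OF circ_left(1)] circ_left(3,4)] circ_left(5)
      by simp
  qed (simp_all add: free_circ_add_right free_circ_scale_right poly_val_add poly_val_scale)
next
  case (circ_right p m n q i)
  from circ_right(1) show ?case
  proof (induction rule: free_component_induct)
    case (of_tree t)
    then show ?case
      using poly_val_circ_tree_left[OF free_ideal_in_component[OF circ_right(2)], of i t \<sigma>] circ_right(3-5)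
        tree_val_upd_lin(2)[of i t "spread i n \<sigma>" 0 0]
      by simp
  qed (simp_all add: free_circ_add_left free_circ_scale_left poly_val_add poly_val_scale)
qed (simp_all add: poly_val_add poly_val_scale)

lemma poly_val_total_ideal:
  assumes "p \<in> total_ideal preAsI_relators"
  shows "poly_val \<sigma> p = 0"
proof -
  have "free.subspace {p. poly_val \<sigma> p = 0}"
    by (rule free.subspaceI) (simp_all add: poly_val_add poly_val_scale)
  moreover have "(\<Union>n. {p. free_ideal preAsI_relators n p}) \<subseteq> {p. poly_val \<sigma> p = 0}"
    by (auto simp: poly_val_ideal)
  ultimately show ?thesis
    using assms free.span_minimal unfolding total_ideal_def by blast
qed

text \<open>Evaluation with the generator x at every leaf descends to the quotient. It serves to
  tell the classes of distinct words apart.\<close>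

lift_definition class_val :: "'k::field preAsI \<Rightarrow> (word \<Rightarrow>\<^sub>0 'k)" is "poly_val (\<lambda>_. sg (Gen Emp))"
  unfolding preAsI_rel_def by (drule poly_val_total_ideal) (simp add: poly_val_diff)

lemma class_val_add: "class_val (p + q) = class_val p + class_val q"
  by transfer (rule poly_val_add)

lemma class_val_scale: "class_val (preAsI_scale c p) = scal c (class_val p)"
  by transfer (rule poly_val_scale)

section \<open>The operad as the free algebra on one generator\<close>

definition cls :: "pre_op tree \<Rightarrow> 'k::field preAsI" where
  "cls t = abs_preAsI (of_tree t)"

text \<open>Input 2 is filled before input 1, so that filling one does not renumber the
  other.\<close>

definition node :: "pre_op \<Rightarrow> 'k::field preAsI \<Rightarrow> 'k preAsI \<Rightarrow> 'k preAsI" where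
  "node g p q = preAsI_circ (preAsI_circ (cls \<langle>\<langle>\<rangle>, g, \<langle>\<rangle>\<rangle>) 2 q) 1 p"

lemma node_cls: "node g (cls l) (cls r) = cls \<langle>l, g, r\<rangle>"
  by (simp add: node_def cls_def preAsI_circ.abs_eq free_circ_of_tree)

lemma node_add_left: "node g (p + p') q = node g p q + node g p' q"
  and node_add_right: "node g p (q + q') = node g p q + node g p q'"
  and node_scale_left: "node g (preAsI_scale c p) q = preAsI_scale c (node g p q)"
  and node_scale_right: "node g p (preAsI_scale c q) = preAsI_scale c (node g p q)"
  by (simp_all add: node_def preAsI_circ_bilinear)

lemma preAsI_induct [case_names tree add scale]:
  assumes "\<And>t. Q (cls t)" "\<And>p q. Q p \<Longrightarrow> Q q \<Longrightarrow> Q (p + q)" "\<And>c p. Q p \<Longrightarrow> Q (preAsI_scale c p)"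
  shows "Q p"
proof -
  have "Q (abs_preAsI p)" for p
  proof (induction p rule: poly_induct)
    case zero
    show ?case using assms(3)[OF assms(1), of 0] by (simp add: zero_preAsI.abs_eq)
  qed (use assms in \<open>simp_all add: cls_def flip: plus_preAsI.abs_eq preAsI_scale.abs_eq\<close>)
  then show ?thesis by (metis Quotient3_abs_rep Quotient3_preAsI)
qed

lemma class_val_cls: "class_val (cls t) = tree_val t (\<lambda>_. sg (Gen Emp))"
  by (simp add: cls_def class_val.abs_eq poly_val_of_tree)

lemma class_val_node: "class_val (node g p q) = model_op g (class_val p) (class_val q)"
proof (induction p rule: preAsI_induct)
  case (tree l)
  show ?case
    by (induction q rule: preAsI_induct)
      (simp_all add: node_cls class_val_cls node_add_right node_scale_right class_val_add class_val_scale model_op_add_right model_op_scal_right)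
qed (simp_all add: node_add_left node_scale_left class_val_add class_val_scale model_op_add_left model_op_scal_left)

definition pmul :: "'k::field preAsI \<Rightarrow> 'k preAsI \<Rightarrow> 'k preAsI" where
  "pmul p q = node Prec p q + node Succ p q"

lemma pmul_lin: "pmul (p + p') q = pmul p q + pmul p' q" "pmul p (q + q') = pmul p q + pmul p q'"
  "pmul (preAsI_scale c p) q = preAsI_scale c (pmul p q)" "pmul p (preAsI_scale c q) = preAsI_scale c (pmul p q)"
  by (simp_all add: pmul_def node_add_left node_add_right node_scale_left node_scale_right preAsI.scale_right_distrib)

text \<open>The relators speak about leaves only. Plugging trees into them, last input first to keep
  the numbering, gives the relations for arbitrary trees.\<close>

lemma relator_instance:
  assumes "r \<in> preAsI_relators"
  shows "free_circ (free_circ (free_circ r 3 (of_tree z)) 2 (of_tree y)) 1 (of_tree x)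
    \<in> total_ideal preAsI_relators"
proof -
  have "free_ideal preAsI_relators 3 r"
    by (rule free_ideal.generator[OF assms preAsI_relators_in_component[OF assms]])
  then have "r \<in> total_ideal preAsI_relators"
    unfolding total_ideal_def by (intro free.span_base) auto
  then show ?thesis by (intro total_ideal_circ_left)
qed

lemma free_circ_diff_left: "free_circ (p - p') i q = free_circ p i q - free_circ p' i q"
  using free_circ_add_left[of "p - p'" p' i q] by (simp add: algebra_simps)

lemma abs_diff: "abs_preAsI p - abs_preAsI q = abs_preAsI (p - q)"
  by (simp add: minus_preAsI.abs_eq)

lemma abs_eq_zero: "p \<in> total_ideal preAsI_relators \<Longrightarrow> abs_preAsI p = 0"
  by (simp add: zero_preAsI.abs_eq preAsI.abs_eq_iff preAsI_rel_def)

lemma cls_assoc: "pmul (pmul (cls x) (cls y)) (cls z) = pmul (cls x) (pmul (cls y) (cls z) :: 'k::field preAsI)"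
  and cls_entangle: "node Succ (cls x) (node Prec (cls y) (cls z)) = node Prec (node Succ (cls x) (cls y)) (cls z :: 'k preAsI)"
proof -
  let ?A = "of_tree ((x \<succ>\<^sub>t y) \<succ>\<^sub>t z) + of_tree ((x \<prec>\<^sub>t y) \<succ>\<^sub>t z)
       - of_tree (x \<succ>\<^sub>t (y \<succ>\<^sub>t z)) + of_tree ((x \<prec>\<^sub>t y) \<prec>\<^sub>t z)
       - of_tree (x \<prec>\<^sub>t (y \<succ>\<^sub>t z)) - of_tree (x \<prec>\<^sub>t (y \<prec>\<^sub>t z)) :: pre_op tree \<Rightarrow>\<^sub>0 'k"
  let ?Bra = "of_tree (x \<succ>\<^sub>t (y \<prec>\<^sub>t z)) - of_tree ((x \<succ>\<^sub>t y) \<prec>\<^sub>t z) :: pre_op tree \<Rightarrow>\<^sub>0 'k"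
  have "\<forall>r \<in> preAsI_relators. free_circ (free_circ (free_circ r 3 (of_tree z)) 2 (of_tree y)) 1 (of_tree x)
      \<in> (total_ideal preAsI_relators :: (pre_op tree \<Rightarrow>\<^sub>0 'k) set)"
    using relator_instance by blast
  then have "{?A, ?Bra} \<subseteq> total_ideal preAsI_relators"
    by (subst (asm) (1) preAsI_relators_def)
      (simp add: free_circ_add_left free_circ_diff_left free_circ_of_tree)
  then have A: "abs_preAsI ?A = 0" and Bra: "abs_preAsI ?Bra = 0"
    by (simp_all add: abs_eq_zero)
  from Bra have "cls (x \<succ>\<^sub>t (y \<prec>\<^sub>t z)) - cls ((x \<succ>\<^sub>t y) \<prec>\<^sub>t z) = (0 :: 'k preAsI)"
    by (simp add: cls_def abs_diff)
  then show Bra': "node Succ (cls x) (node Prec (cls y) (cls z)) = node Prec (node Succ (cls x) (cls y)) (cls z :: 'k preAsI)"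
    by (simp add: node_cls)
  from A have "cls ((x \<succ>\<^sub>t y) \<succ>\<^sub>t z) + cls ((x \<prec>\<^sub>t y) \<succ>\<^sub>t z)
       - cls (x \<succ>\<^sub>t (y \<succ>\<^sub>t z)) + cls ((x \<prec>\<^sub>t y) \<prec>\<^sub>t z)
       - cls (x \<prec>\<^sub>t (y \<succ>\<^sub>t z)) - cls (x \<prec>\<^sub>t (y \<prec>\<^sub>t z)) = (0 :: 'k preAsI)"
    by (simp add: cls_def plus_preAsI.abs_eq abs_diff)
  \<comment> \<open>Modulo the second relation, the first relator is the difference of the two
    bracketings of a triple product.\<close>
  with Bra' show "pmul (pmul (cls x) (cls y)) (cls z) = pmul (cls x) (pmul (cls y) (cls z) :: 'k preAsI)"
    by (simp add: pmul_def node_add_left node_add_right node_cls algebra_simps)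
qed

lemma pmul_assoc: "pmul (pmul p q) s = pmul p (pmul q s)"
proof (induction p rule: preAsI_induct)
  case (tree x)
  show ?case
  proof (induction q rule: preAsI_induct)
    case (tree y)
    show ?case
      by (induction s rule: preAsI_induct) (simp_all add: cls_assoc pmul_lin)
  qed (simp_all add: pmul_lin)
qed (simp_all add: pmul_lin)

lemma node_entangle: "node Prec (node Succ p q) s = node Succ p (node Prec q s)"
proof (induction p rule: preAsI_induct)
  case (tree x)
  show ?case
  proof (induction q rule: preAsI_induct)
    case (tree y)
    show ?case
      by (induction s rule: preAsI_induct) (simp_all add: cls_entangle node_add_right node_scale_right)
  qed (simp_all add: node_add_left node_add_right node_scale_left node_scale_right)
qed (simp_all add: node_add_left node_scale_left)

section \<open>The dimension as a number of words\<close>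

primrec good :: "word \<Rightarrow> bool" where
  "good Emp = True"
| "good (Gen r) = good r"
| "good (Bra v a r) = (good v \<and> good a \<and> a \<noteq> Emp \<and> good r)"

lemma good_plus [simp]: "good (u + z) \<longleftrightarrow> good u \<and> good z"
  by (induction u) auto

lemma plus_eq_Emp [simp]: "u + z = Emp \<longleftrightarrow> u = Emp \<and> z = Emp"
  by (cases u) auto

definition words :: "nat \<Rightarrow> word set" where
  "words n = {u. good u \<and> deg u = n}"

text \<open>The operad has no unit for \<open>*\<close>, so the value on the empty word is junk.\<close>

primrec word_cls :: "word \<Rightarrow> 'k::field preAsI" where
  "word_cls Emp = 0"
| "word_cls (Gen r) = (if r = Emp then cls \<langle>\<rangle> else pmul (cls \<langle>\<rangle>) (word_cls r))"
| "word_cls (Bra v a r) =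
     (let h = node Succ (if v = Emp then cls \<langle>\<rangle> else pmul (cls \<langle>\<rangle>) (word_cls v)) (word_cls a)
      in if r = Emp then h else pmul h (word_cls r))"

lemma word_cls_Bra_Emp: "word_cls (Bra v a Emp) = node Succ (word_cls (Gen v)) (word_cls a)"
  by simp

lemma word_cls_plus:
  assumes "u \<noteq> Emp" "z \<noteq> Emp"
  shows "word_cls (u + z) = pmul (word_cls u) (word_cls z)"
  using assms by (induction u) (auto simp: pmul_assoc Let_def)

lemma class_val_pmul: "class_val (pmul p q) = class_val p * class_val q"
  by (simp add: pmul_def class_val_add class_val_node succ_def)

text \<open>The classes of good nonempty words evaluate to distinct basis vectors, which will give
  linear independence. Goodness enters because \<open>bracket\<close> kills the empty word.\<close>

lemma class_val_word_cls: "good u \<Longrightarrow> u \<noteq> Emp \<Longrightarrow> class_val (word_cls u) = sg u"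
proof (induction u)
  case (Gen r)
  then show ?case by (simp add: class_val_cls class_val_pmul sg_mult)
next
  case (Bra v a r)
  have "class_val (if v = Emp then cls \<langle>\<rangle> else pmul (cls \<langle>\<rangle>) (word_cls v)) = (sg (Gen v) :: word \<Rightarrow>\<^sub>0 'a)"
    using Bra by (simp add: class_val_cls class_val_pmul sg_mult)
  then have "class_val (node Succ (if v = Emp then cls \<langle>\<rangle> else pmul (cls \<langle>\<rangle>) (word_cls v)) (word_cls a)) = (sg (Bra v a Emp) :: word \<Rightarrow>\<^sub>0 'a)"
    using Bra by (simp add: class_val_node succ_Gen bracket_sg del: if_split)
  then show ?case using Bra by (simp add: Let_def class_val_pmul sg_mult del: if_split)
qed simp

section \<open>Good words span the components\<close>

definition word_span :: "nat \<Rightarrow> 'k::field preAsI set" where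
  "word_span n = preAsI.span (word_cls ` words n)"

lemma subspace_word_span: "preAsI.subspace (word_span n)"
  by (simp add: word_span_def)

lemmas word_span_closed = preAsI.subspace_0[OF subspace_word_span] preAsI.subspace_add[OF subspace_word_span]
  preAsI.subspace_diff[OF subspace_word_span] preAsI.subspace_scale[OF subspace_word_span]

lemma word_cls_in_word_span: "good u \<Longrightarrow> deg u = n \<Longrightarrow> word_cls u \<in> word_span n"
  unfolding word_span_def words_def by (intro preAsI.span_base imageI) simp

lemma bilinear_word_span:
  assumes "\<And>p p' q. F (p + p') q = F p q + F p' q" "\<And>c p q. F (preAsI_scale c p) q = preAsI_scale c (F p q)"
    and "\<And>p q q'. F p (q + q') = F p q + F p q'" "\<And>c p q. F p (preAsI_scale c q) = preAsI_scale c (F p q)"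
    and base: "\<And>u z. good u \<Longrightarrow> good z \<Longrightarrow> deg u = m \<Longrightarrow> deg z = n \<Longrightarrow> F (word_cls u) (word_cls z) \<in> word_span k"
    and "p \<in> word_span m" "q \<in> word_span n"
  shows "F p q \<in> word_span k"
proof -
  have z: "F 0 q = 0" "F p 0 = 0" for p q
    using assms(2)[of 0 0 q] assms(4)[of p 0 0] by simp_all
  have "F (word_cls u) q \<in> word_span k" if "good u" "deg u = m" for u
  proof -
    have "preAsI.subspace {q. F (word_cls u) q \<in> word_span k}"
      by (rule preAsI.subspaceI) (simp_all add: assms z word_span_closed)
    moreover have "word_cls ` words n \<subseteq> {q. F (word_cls u) q \<in> word_span k}"
      using base that by (auto simp: words_def)
    ultimately show ?thesis
      using assms(7) preAsI.span_minimal unfolding word_span_def[of n] by blast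
  qed
  then have "word_cls ` words m \<subseteq> {p. F p q \<in> word_span k}"
    by (auto simp: words_def)
  moreover have "preAsI.subspace {p. F p q \<in> word_span k}"
    by (rule preAsI.subspaceI) (simp_all add: assms z word_span_closed)
  ultimately show ?thesis
    using assms(6) preAsI.span_minimal unfolding word_span_def[of m] by blast
qed

lemma node_zero [simp]: "node g 0 q = 0" "node g p 0 = 0"
  using node_scale_left[of g 0 0 q] node_scale_right[of g p 0 0] by simp_all

lemma pmul_zero [simp]: "pmul 0 q = 0" "pmul p 0 = 0"
  by (simp_all add: pmul_def)

lemma pmul_word_span:
  assumes "p \<in> word_span m" "q \<in> word_span n"
  shows "pmul p q \<in> word_span (m + n)"
  using _ assms
proof (rule bilinear_word_span[of pmul, rotated 4])
  fix u z assume "good u" "good z" "deg u = m" "deg z = n"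
  then show "pmul (word_cls u) (word_cls z) \<in> word_span (m + n)"
    by (cases "u = Emp"; cases "z = Emp") (simp_all add: word_span_closed word_cls_in_word_span flip: word_cls_plus)
qed (simp_all add: pmul_lin)

lemma node_Prec_eq: "node Prec p q = pmul p q - node Succ p q"
  by (simp add: pmul_def)

text \<open>With h = w \<succ> a, entanglement rewrites (h * r) \<prec> z through h \<prec> y = w
  \<succ> (a \<prec> y) and (h \<succ> r) \<prec> z = h \<succ> (r \<prec> z). Subtracting the
  result from (h * r) * z = h * (r * z) gives the formula.\<close>

lemma succ_pmul_succ:
  "node Succ (pmul (node Succ w a) r) z = pmul (node Succ w a) (node Succ r z)
     + node Succ w (node Prec a (node Prec r z) - node Prec (node Prec a r) z)"
proof -
  let ?h = "node Succ w a"
  have d: "node Succ w (p - q) = node Succ w p - node Succ w q" for p q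
    using node_add_right[of Succ w "p - q" q] by (simp add: algebra_simps)
  have "node Prec (pmul ?h r) z = node Succ w (node Prec (node Prec a r) z) + node Succ ?h (node Prec r z)"
    by (simp add: pmul_def node_add_left node_entangle)
  also have "node Succ ?h (node Prec r z) = pmul ?h (node Prec r z) - node Succ w (node Prec a (node Prec r z))"
    by (simp add: pmul_def node_entangle)
  finally have "node Prec (pmul ?h r) z = node Succ w (node Prec (node Prec a r) z)
    + (pmul ?h (node Prec r z) - node Succ w (node Prec a (node Prec r z)))" .
  moreover have "pmul (pmul ?h r) z = pmul ?h (node Prec r z) + pmul ?h (node Succ r z)"
    unfolding pmul_assoc pmul_def[of r z] by (rule pmul_lin)
  moreover have "node Succ (pmul ?h r) z = pmul (pmul ?h r) z - node Prec (pmul ?h r) z"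
    by (simp add: pmul_def[of "pmul ?h r" z])
  ultimately have "node Succ (pmul ?h r) z = pmul ?h (node Prec r z) + pmul ?h (node Succ r z)
    - (node Succ w (node Prec (node Prec a r) z)
      + (pmul ?h (node Prec r z) - node Succ w (node Prec a (node Prec r z))))"
    by (simp only:)
  then show ?thesis by (simp add: d)
qed

text \<open>For a good nonempty word z, the element (x v) \<succ> z is a single letter; for z empty
  it is zero.\<close>

lemma node_Succ_Gen_word_span:
  fixes q :: "'k::field preAsI"
  assumes "good v" "q \<in> word_span n"
  shows "node Succ (word_cls (Gen v)) q \<in> word_span (1 + deg v + n)"
proof -
  have "node Succ (word_cls (Gen v)) (word_cls z :: 'k preAsI) \<in> word_span (1 + deg v + n)" if "good z" "deg z = n" for z
    using that assms
    by (cases "z = Emp") (auto simp: word_span_closed simp del: word_cls.simps(2,3) simp flip: word_cls_Bra_Emp intro!: word_cls_in_word_span)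
  then have "word_cls ` words n \<subseteq> {q :: 'k preAsI. node Succ (word_cls (Gen v)) q \<in> word_span (1 + deg v + n)}"
    by (auto simp: words_def simp del: word_cls.simps)
  moreover have "preAsI.subspace {q :: 'k preAsI. node Succ (word_cls (Gen v)) q \<in> word_span (1 + deg v + n)}"
    by (rule preAsI.subspaceI) (simp_all add: node_add_right node_scale_right word_span_closed)
  ultimately show ?thesis
    using assms(2) preAsI.span_minimal unfolding word_span_def[of n] by blast
qed

text \<open>Induction on the total degree: the rewriting rule reduces the operation to products, to
  operations of smaller total degree, and to left factors x v.\<close>

lemma node_Succ_word_cls_word_span:
  "good u \<Longrightarrow> good z \<Longrightarrow> node Succ (word_cls u) (word_cls z :: 'k::field preAsI) \<in> word_span (deg u + deg z)"
proof (induction "deg u + deg z" arbitrary: u z rule: less_induct)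
  case less
  have S: "node Succ p q \<in> word_span (m + n)"
    if "p \<in> word_span m" "q \<in> word_span n" "m + n < deg u + deg z" for m n and p q :: "'k preAsI"
    using _ that(1,2)
  proof (rule bilinear_word_span[of "node Succ", rotated 4])
    fix u' z' assume "good u'" "good z'" "deg u' = m" "deg z' = n"
    then show "node Succ (word_cls u') (word_cls z' :: 'k preAsI) \<in> word_span (m + n)"
      using less.hyps[of u' z'] that(3) by simp
  qed (simp_all add: node_add_left node_add_right node_scale_left node_scale_right)
  have P: "node Prec p q \<in> word_span (m + n)"
    if "p \<in> word_span m" "q \<in> word_span n" "m + n < deg u + deg z" for m n and p q :: "'k preAsI"
    unfolding node_Prec_eq using that by (intro word_span_closed pmul_word_span S)
  have z: "(word_cls z :: 'k preAsI) \<in> word_span (deg z)" using less by (simp add: word_cls_in_word_span)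
  show ?case
  proof (cases u)
    case Emp
    then show ?thesis by (simp add: word_span_closed)
  next
    case (Gen r)
    then show ?thesis using node_Succ_Gen_word_span[OF _ z, of r] less by simp
  next
    case (Bra v a r)
    let ?w = "word_cls (Gen v) :: 'k preAsI" and ?a = "word_cls a :: 'k preAsI"
      and ?r = "word_cls r :: 'k preAsI" and ?z = "word_cls z :: 'k preAsI"
    let ?h = "node Succ ?w ?a"
    have g: "good v" "good a" "good r" "a \<noteq> Emp" using less Bra by auto
    have h: "?h \<in> word_span (1 + deg v + deg a)"
      unfolding word_cls_Bra_Emp[symmetric] using g by (intro word_cls_in_word_span) auto
    have a: "?a \<in> word_span (deg a)" and r: "?r \<in> word_span (deg r)"
      using g by (auto simp: word_cls_in_word_span)
    have N: "deg u + deg z = 1 + deg v + (deg a + (deg r + deg z))"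
      "deg u + deg z = (1 + deg v + deg a) + (deg r + deg z)"
      by (simp_all add: Bra)
    show ?thesis
    \<comment> \<open>\<open>word_cls Emp\<close> is 0 and not a unit, so the rewriting rule does
      not cover r empty. There entanglement alone gives h \<prec> z = w \<succ> (a \<prec>
      z).\<close>
    proof (cases "r = Emp")
      case True
      then have u: "word_cls u = ?h" unfolding Bra by (simp only: word_cls_Bra_Emp)
      have "node Succ (word_cls u) ?z = pmul ?h ?z - node Succ ?w (node Prec ?a ?z)"
        unfolding u by (simp add: pmul_def node_entangle del: word_cls.simps)
      moreover have "pmul ?h ?z \<in> word_span (deg u + deg z)"
        using pmul_word_span[OF h z] N(2) True by simp
      moreover have "node Prec ?a ?z \<in> word_span (deg a + deg z)"
        by (rule P[OF a z]) (simp add: Bra)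
      from node_Succ_Gen_word_span[OF g(1) this]
      have "node Succ ?w (node Prec ?a ?z) \<in> word_span (deg u + deg z)"
        using N(1) True by (simp add: add.assoc del: word_cls.simps)
      ultimately show ?thesis by (simp only: word_span_closed)
    next
      case False
      have "word_cls u = pmul ?h ?r" using False by (simp add: Bra Let_def)
      then have "node Succ (word_cls u) ?z = pmul ?h (node Succ ?r ?z)
          + node Succ ?w (node Prec ?a (node Prec ?r ?z) - node Prec (node Prec ?a ?r) ?z)"
        by (simp only: succ_pmul_succ)
      moreover have "node Succ ?r ?z \<in> word_span (deg r + deg z)"
        by (rule S[OF r z]) (simp add: Bra)
      from pmul_word_span[OF h this] have "pmul ?h (node Succ ?r ?z) \<in> word_span (deg u + deg z)"
        by (simp only: N(2))
      moreover have "node Prec ?a (node Prec ?r ?z) \<in> word_span (deg a + (deg r + deg z))"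
        by (rule P[OF a P[OF r z]]) (simp_all add: Bra)
      moreover have "node Prec (node Prec ?a ?r) ?z \<in> word_span (deg a + deg r + deg z)"
        by (rule P[OF P[OF a r] z]) (use g in \<open>auto simp: Bra\<close>)
      ultimately show ?thesis
        unfolding N(1)
        by (simp only: word_span_closed add.assoc node_Succ_Gen_word_span[OF g(1), of _ "deg a + (deg r + deg z)", unfolded add.assoc])
    qed
  qed
qed

lemma node_word_span:
  assumes "p \<in> word_span m" "q \<in> word_span n"
  shows "node g p q \<in> word_span (m + n)"
proof -
  have S: "node Succ p q \<in> word_span (m + n)"
    using _ assms
    by (rule bilinear_word_span[of "node Succ", rotated 4])
      (auto simp: node_add_left node_add_right node_scale_left node_scale_right node_Succ_word_cls_word_span)
  then show ?thesis
    using assms by (cases g) (auto simp: node_Prec_eq word_span_closed pmul_word_span)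
qed

lemma cls_word_span: "cls t \<in> word_span (size1 t)"
proof (induction t)
  case Leaf
  show ?case using word_cls_in_word_span[of "Gen Emp" 1] by simp
next
  case (Node l g r)
  then show ?case using node_word_span[of "cls l" _ "cls r"] by (simp add: node_cls)
qed

lemma preAsI_component_subset: "preAsI_component n \<subseteq> word_span n"
proof -
  have "abs_preAsI p \<in> word_span n" if "p \<in> free_component n" for p :: "pre_op tree \<Rightarrow>\<^sub>0 'a"
    using that
  proof (induction rule: free_component_induct)
    case (of_tree t)
    then show ?case using cls_word_span[of t] by (simp add: cls_def)
  next
    case zero
    show ?case unfolding zero_preAsI.abs_eq[symmetric] by (rule word_span_closed)
  qed (simp_all add: word_span_closed flip: plus_preAsI.abs_eq preAsI_scale.abs_eq)
  then show ?thesis by (auto simp: preAsI_component_def)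
qed

lemma node_component:
  assumes "p \<in> preAsI_component m" "q \<in> preAsI_component n"
  shows "node g p q \<in> preAsI_component (m + n)"
proof -
  have "cls \<langle>\<langle>\<rangle>, g, \<langle>\<rangle>\<rangle> \<in> preAsI_component 2"
    unfolding cls_def preAsI_component_def
    using of_tree_in_component[of "\<langle>\<langle>\<rangle>, g, \<langle>\<rangle>\<rangle>"] by (auto simp: numeral_2_eq_2)
  from preAsI.circ_in[OF preAsI.circ_in[OF this assms(2)] assms(1), of 2 1]
  show ?thesis by (simp add: node_def add.commute)
qed

lemma pmul_component:
  "p \<in> preAsI_component m \<Longrightarrow> q \<in> preAsI_component n \<Longrightarrow> pmul p q \<in> preAsI_component (m + n)"
  unfolding pmul_def
  by (intro preAsI.subspace_add[OF preAsI.subspace_component] node_component)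

lemma word_cls_component: "(word_cls u :: 'k::field preAsI) \<in> preAsI_component (deg u)"
proof (induction u)
  case Emp
  show ?case by (simp add: preAsI.subspace_0[OF preAsI.subspace_component])
next
  case (Gen r)
  have "(cls \<langle>\<rangle> :: 'k preAsI) \<in> preAsI_component 1" using preAsI.one_in by (simp add: cls_def preAsI_one.abs_eq)
  then show ?case using Gen pmul_component[of "cls \<langle>\<rangle>" 1 "word_cls r :: 'k preAsI"] by simp
next
  case (Bra v a r)
  have "(cls \<langle>\<rangle> :: 'k preAsI) \<in> preAsI_component 1" using preAsI.one_in by (simp add: cls_def preAsI_one.abs_eq)
  then have "(word_cls (Gen v) :: 'k preAsI) \<in> preAsI_component (1 + deg v)"
    using Bra pmul_component[of "cls \<langle>\<rangle>" 1 "word_cls v :: 'k preAsI"] by simp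
  from node_component[OF this Bra(2), of Succ]
  have h: "(word_cls (Bra v a Emp) :: 'k preAsI) \<in> preAsI_component (1 + deg v + deg a)" by simp
  then show ?case
    using pmul_component[OF h Bra(3)] by (cases "r = Emp") (simp_all add: Let_def)
qed

lemma preAsI_component_eq: "preAsI_component n = word_span n"
proof
  show "word_span n \<subseteq> preAsI_component n"
    unfolding word_span_def
    by (intro preAsI.span_minimal preAsI.subspace_component) (auto simp: words_def word_cls_component)
qed (rule preAsI_component_subset)

section \<open>Finiteness and independence of the words\<close>

lemma finite_deg_le: "finite {u. deg u \<le> n}"
proof (induction n)
  case 0
  have "{u. deg u \<le> 0} \<subseteq> {Emp}"
  proof
    fix u assume "u \<in> {u. deg u \<le> 0}"
    then show "u \<in> {Emp}" by (cases u) auto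
  qed
  then show ?case by (rule finite_subset) simp
next
  case (Suc n)
  let ?D = "{u. deg u \<le> n}"
  \<comment> \<open>The entries of a word may have any smaller degree, hence the induction on a
    bound instead of the exact degree.\<close>
  have "{u. deg u \<le> Suc n} \<subseteq> {Emp} \<union> Gen ` ?D \<union> (\<lambda>(v, a, r). Bra v a r) ` (?D \<times> ?D \<times> ?D)"
  proof
    fix u assume "u \<in> {u. deg u \<le> Suc n}"
    then show "u \<in> {Emp} \<union> Gen ` ?D \<union> (\<lambda>(v, a, r). Bra v a r) ` (?D \<times> ?D \<times> ?D)"
      by (cases u) (auto simp: image_iff)
  qed
  then show ?case by (rule finite_subset) (use Suc in auto)
qed

lemma finite_words: "finite (words n)"
  by (rule finite_subset[OF _ finite_deg_le[of n]]) (auto simp: words_def)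

text \<open>The classes of words span by \<open>preAsI_component_eq\<close> and are independent
  because the model separates them. In arity 0 the empty word would be counted although its class is
  zero.\<close>

lemma dim_preAsI_component:
  assumes "n \<ge> 1"
  shows "preAsI.dim (preAsI_component n :: 'k::field preAsI set) = card (words n)"
proof -
  have ev: "class_val (word_cls u) = (sg u :: word \<Rightarrow>\<^sub>0 'k)" if "u \<in> words n" for u
    using that assms by (intro class_val_word_cls) (auto simp: words_def)
  have inj: "inj_on (word_cls :: _ \<Rightarrow> 'k preAsI) (words n)"
  proof
    fix u z assume "u \<in> words n" "z \<in> words n" "word_cls u = (word_cls z :: 'k preAsI)"
    then have "sg u = (sg z :: word \<Rightarrow>\<^sub>0 'k)" using ev[of u] ev[of z] by simp
    then have "Poly_Mapping.keys (sg u :: word \<Rightarrow>\<^sub>0 'k) = Poly_Mapping.keys (sg z :: word \<Rightarrow>\<^sub>0 'k)"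
      by (rule arg_cong)
    then show "u = z" by simp
  qed
  have "preAsI.independent (word_cls ` words n :: 'k preAsI set)"
  proof
    assume "preAsI.dependent (word_cls ` words n :: 'k preAsI set)"
    then obtain c where c: "\<exists>v \<in> word_cls ` words n. c v \<noteq> (0 :: 'k)"
      "(\<Sum>v \<in> word_cls ` words n. preAsI_scale (c v) v) = 0"
      unfolding preAsI.dependent_finite[OF finite_imageI[OF finite_words]] by blast
    have class_val_0: "class_val 0 = (0 :: word \<Rightarrow>\<^sub>0 'k)" using class_val_scale[of 0 0] by simp
    have class_val_sum: "class_val (sum f A) = (\<Sum>x\<in>A. class_val (f x) :: word \<Rightarrow>\<^sub>0 'k)" for f and A :: "word set"
      by (induction A rule: infinite_finite_induct) (simp_all add: class_val_0 class_val_add)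
    \<comment> \<open>Evaluating a linear relation between classes in the model makes it a relation
      between basis vectors, whose coefficients can be read off.\<close>
    have "0 = class_val (\<Sum>u \<in> words n. preAsI_scale (c (word_cls u)) (word_cls u))"
      using c(2) by (simp add: sum.reindex[OF inj] class_val_0)
    also have "\<dots> = (\<Sum>u \<in> words n. Poly_Mapping.single u (c (word_cls u)))"
      unfolding class_val_sum by (intro sum.cong) (simp_all add: class_val_scale ev)
    finally have 0: "(\<Sum>u \<in> words n. Poly_Mapping.single u (c (word_cls u))) = 0" ..
    have "c (word_cls t) = 0" if "t \<in> words n" for t
    proof -
      have "c (word_cls t) = (\<Sum>u \<in> words n. if u = t then c (word_cls u) else 0)"
        using that finite_words[of n] by simp
      also have "\<dots> = Poly_Mapping.lookup (\<Sum>u \<in> words n. Poly_Mapping.single u (c (word_cls u))) t"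
        by (simp add: lookup_sum lookup_single when_def)
      finally show ?thesis by (simp add: 0)
    qed
    with c(1) show False by auto
  qed
  then show ?thesis
    unfolding preAsI_component_eq word_span_def
    by (simp add: preAsI.dim_eq_card_independent card_image[OF inj])
qed

section \<open>Counting the words\<close>

text \<open>Leaving out the empty word makes the constant term zero, so the series can be
  substituted into others.\<close>

definition word_series :: "rat fps" where
  "word_series = Abs_fps (\<lambda>n. of_nat (card (words n - {Emp})))"

lemma words_0: "words 0 = {Emp}"
proof -
  have "u = Emp" if "deg u = 0" for u using that by (cases u) auto
  then show ?thesis by (auto simp: words_def)
qed

lemma Emp_words: "Emp \<in> words n \<longleftrightarrow> n = 0"
  by (auto simp: words_def)

lemma Abs_fps_card_words: "Abs_fps (\<lambda>n. of_nat (card (words n))) = 1 + word_series"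
proof (rule fps_ext)
  fix n show "Abs_fps (\<lambda>n. of_nat (card (words n))) $ n = (1 + word_series) $ n"
    by (cases n) (simp_all add: word_series_def words_0 Emp_words)
qed

text \<open>The degrees of v, a and r are i, j and n - i - j; the nested union has the shape that
  lets \<open>card_convolution\<close> be applied twice.\<close>

lemma words_Suc:
  "words (Suc n) = Gen ` words n \<union> (\<lambda>(v, a, r). Bra v a r) `
     (\<Union>i \<in> {0..n}. words i \<times> (\<Union>j \<in> {0..n - i}. (words j - {Emp}) \<times> words (n - i - j)))"
  (is "_ = _ \<union> ?f ` ?S")
proof (rule set_eqI)
  fix u
  show "u \<in> words (Suc n) \<longleftrightarrow> u \<in> Gen ` words n \<union> ?f ` ?S"
  proof (cases u)
    case Emp
    then show ?thesis by (auto simp: words_def)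
  next
    case (Gen r)
    then show ?thesis by (auto simp: words_def)
  next
    case (Bra v a r)
    have "u \<in> ?f ` ?S \<longleftrightarrow> (v, a, r) \<in> ?S"
      unfolding Bra by (simp add: image_iff split_beta)
    moreover have "(v, a, r) \<in> ?S \<longleftrightarrow> u \<in> words (Suc n)"
      unfolding Bra by (auto simp: words_def)
    moreover have "u \<notin> Gen ` words n" unfolding Bra by blast
    ultimately show ?thesis by blast
  qed
qed

text \<open>A nonempty word is x r, contributing X (1 + f), or [x v, a] r with a nonempty,
  contributing X (1 + f) f (1 + f).\<close>

lemma word_series_eq: "word_series = fps_X * (((1 + fps_X) * (1 + fps_X + fps_X ^ 2)) oo word_series)"
proof -
  let ?f = word_series
  have card_Suc: "of_nat (card (words (Suc n))) = ((1 + ?f) + (1 + ?f) * (?f * (1 + ?f))) $ n" for n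
  proof -
    let ?T = "\<lambda>m. \<Union>j \<in> {0..m}. (words j - {Emp}) \<times> words (m - j)"
    let ?S = "\<Union>i \<in> {0..n}. words i \<times> ?T (n - i)"
    have disj: "words i \<inter> words j = {}" if "i \<noteq> j" for i j
      using that by (auto simp: words_def)
    have T: "Abs_fps (\<lambda>m. of_nat (card (?T m))) = ?f * (1 + ?f)"
    proof (rule fps_ext)
      fix m
      have "of_nat (card (?T m)) = (Abs_fps (\<lambda>n. of_nat (card (words n - {Emp})))
          * Abs_fps (\<lambda>n. of_nat (card (words n))) :: rat fps) $ m"
        by (rule card_convolution) (use disj in \<open>auto simp: finite_words\<close>)
      then show "Abs_fps (\<lambda>m. of_nat (card (?T m))) $ m = (?f * (1 + ?f)) $ m"
        by (simp add: Abs_fps_card_words flip: word_series_def)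
    qed
    have S: "of_nat (card ?S) = ((1 + ?f) * (?f * (1 + ?f))) $ n"
      unfolding T[symmetric] unfolding Abs_fps_card_words[symmetric]
      by (rule card_convolution) (use disj in \<open>auto simp: finite_words\<close>)
    have fin: "finite ?S" by (auto simp: finite_words)
    have "card (words (Suc n)) = card (Gen ` words n) + card ((\<lambda>(v, a, r). Bra v a r) ` ?S)"
      unfolding words_Suc by (rule card_Un_disjoint) (use fin in \<open>auto simp: finite_words\<close>)
    also have "\<dots> = card (words n) + card ?S"
      by (intro arg_cong2[of _ _ _ _ "(+)"] card_image) (auto simp: inj_on_def)
    finally have "of_nat (card (words (Suc n))) = of_nat (card (words n)) + of_nat (card ?S)"
      by simp
    also have "of_nat (card (words n)) = (1 + ?f) $ n"
      by (simp flip: Abs_fps_card_words)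
    finally show ?thesis by (simp only: S fps_add_nth)
  qed
  have f0: "?f $ 0 = 0" by (simp add: word_series_def words_0)
  have "?f = fps_X * ((1 + ?f) + (1 + ?f) * (?f * (1 + ?f)))"
  proof (rule fps_ext)
    fix n show "?f $ n = (fps_X * ((1 + ?f) + (1 + ?f) * (?f * (1 + ?f)))) $ n"
    proof (cases n)
      case 0 then show ?thesis by (simp add: f0)
    next
      case (Suc m)
      have "?f $ Suc m = of_nat (card (words (Suc m)))"
        by (simp add: word_series_def Emp_words)
      then show ?thesis by (simp only: Suc card_Suc fps_X_mult_nth) simp
    qed
  qed
  also have "(1 + ?f) + (1 + ?f) * (?f * (1 + ?f)) = (1 + ?f) * (1 + ?f + ?f ^ 2)"
    by (simp add: algebra_simps power2_eq_square)
  also have "\<dots> = ((1 + fps_X) * (1 + fps_X + fps_X ^ 2)) oo ?f"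
    by (simp add: fps_compose_mult_distrib[OF f0] fps_compose_add_distrib f0 flip: fps_compose_power[OF f0])
  finally show ?thesis .
qed

lemma fps_one_plus_X_power_nth: "((1 + fps_X) ^ n :: 'a::field_char_0 fps) $ k = of_nat (n choose k)"
  by (simp add: fps_binomial_of_nat[symmetric] binomial_gbinomial)

text \<open>With y = 1 + X the base is y (1 + X y). Expanding the power of 1 + X y leaves X^k
  y^(m+1+k), whose m-th coefficient is again binomial.\<close>

lemma phi_power_nth:
  "(((1 + fps_X) * (1 + fps_X + fps_X ^ 2)) ^ Suc m :: rat fps) $ m
    = (\<Sum>k = 0..m. of_nat (Suc m choose k) * of_nat ((m + k + 1) choose (m - k)))"
proof -
  let ?y = "1 + fps_X :: rat fps"
  have "1 + fps_X + fps_X ^ 2 = fps_X * ?y + 1"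
    by (simp add: algebra_simps power2_eq_square)
  then have "(?y * (1 + fps_X + fps_X ^ 2)) ^ Suc m = ?y ^ Suc m * (fps_X * ?y + 1) ^ Suc m"
    by (simp only: power_mult_distrib)
  also have "\<dots> = (\<Sum>k \<le> Suc m. of_nat (Suc m choose k) * (fps_X ^ k * ?y ^ (Suc m + k)))"
    unfolding binomial_ring[of "fps_X * ?y" 1] sum_distrib_left
    by (intro sum.cong) (simp_all only: power_mult_distrib power_add power_one mult_1_left mult_1_right mult_ac)
  finally have "(?y * (1 + fps_X + fps_X ^ 2)) ^ Suc m $ m
     = (\<Sum>k \<le> Suc m. of_nat (Suc m choose k) * (if m < k then 0 else of_nat ((Suc m + k) choose (m - k))))"
    by (simp only: fps_sum_nth fps_of_nat[symmetric] fps_mult_left_const_nth fps_X_power_mult_nth fps_one_plus_X_power_nth)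
  \<comment> \<open>The term k = m + 1 is divisible by X^(m+1) and drops out.\<close>
  also have "\<dots> = (\<Sum>k = 0..m. of_nat (Suc m choose k) * of_nat ((m + k + 1) choose (m - k)))"
    by (simp add: atLeast0AtMost add.commute)
  finally show ?thesis .
qed

lemma card_words:
  assumes "n \<ge> 1"
  shows "of_nat (card (words n)) = A106228 (n - 1)"
proof -
  obtain m where m: "n = Suc m" using assms by (cases n) auto
  \<comment> \<open>Lagrange inversion for the series itself, that is, with exponent 1.\<close>
  have "of_nat (Suc m) * (word_series $ Suc m) = (((1 + fps_X) * (1 + fps_X + fps_X ^ 2)) ^ Suc m :: rat fps) $ m"
    using fps_lagrange_inversion[OF word_series_eq, of "Suc m" 1] by (simp del: power_Suc)
  moreover have "word_series $ Suc m = of_nat (card (words n))"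
    by (simp add: word_series_def Emp_words m)
  ultimately show ?thesis
    unfolding phi_power_nth by (simp add: m A106228_def field_simps)
qed

theorem mainTheorem5:
  fixes n :: nat
  assumes "n \<ge> 1"
  shows "of_nat (vector_space.dim (preAsI_scale :: 'k::field_char_0 \<Rightarrow> 'k preAsI \<Rightarrow> 'k preAsI)
           (preAsI_component n)) = A106228 (n - 1)"
  using assms by (simp only: dim_preAsI_component card_words)

end
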